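(* For any infinite abelian group $G$: (i) $3\leq X_G(2)\leq 5$; (ii) $4\leq X_G(3)\leq 17$.
   Context: For $A\subset G$ and a positive integer $h$, $hA$ is the set of sums of $h$ not necessarily distinct elements of $A$; $A\sim B$ means finite symmetric difference. $\operatorname{ord}^*_G(A)$ is the least $k$ with $kA\sim G$ ($\infty$ if none). $A$ is a basis if $\operatorname{ord}^*_G(A)<\infty$. For a basis $A$, $a\in A$ is regular if $A\setminus\{a\}$ is still a basis; $A^*$ is the set of regular elements. $X_G(h)=\sup\{\operatorname{ord}^*_G(A\setminus\{a\}) : A\subset G,\ hA\sim G,\ a\in A^*\}$. *)

theory Defs
  imports Complex_Main "HOL-Library.Extended_Nat"
begin

definition sumset_fold :: "nat \<Rightarrow> 'a::ab_group_add set \<Rightarrow> 'a set" where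
  "sumset_fold h A = {\<Sum>i<h. x i | x. \<forall>i<h. x i \<in> A}"

definition almost_eq :: "'a set \<Rightarrow> 'a set \<Rightarrow> bool" (infix "\<sim>" 50) where
  "A \<sim> B \<longleftrightarrow> finite (sym_diff A B)"

text \<open>The least positive \<open>k\<close> with \<open>kA \<sim> G\<close>, where \<open>G\<close> is the whole type;
  the infimum of the empty set in \<^typ>\<open>enat\<close> is \<open>\<infinity>\<close>.\<close>

definition ord_star :: "'a::ab_group_add set \<Rightarrow> enat" where
  "ord_star A = Inf {enat k | k. k > 0 \<and> sumset_fold k A \<sim> UNIV}"

definition is_basis :: "'a::ab_group_add set \<Rightarrow> bool" where
  "is_basis A \<longleftrightarrow> ord_star A < \<infinity>"

definition regular_elements :: "'a::ab_group_add set \<Rightarrow> 'a set" where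
  "regular_elements A = {a \<in> A. is_basis (A - {a})}"

definition X_G :: "'a::ab_group_add itself \<Rightarrow> nat \<Rightarrow> enat" where
  "X_G (_ :: 'a itself) h =
     Sup {ord_star (A - {a}) | (A :: 'a set) a. sumset_fold h A \<sim> UNIV \<and> a \<in> regular_elements A}"

end

theory Submission
  imports Defs "HOL-Library.Product_Plus" "HOL-Library.Numeral_Type"
    "HOL-Computational_Algebra.Primes"
begin

text \<open>
  Upper bounds: translate so that the removed element is \<open>0\<close> and let \<open>S\<^sub>k = kB\<close>. If \<open>x \<notin> S\<^sub>n\<close> then
  \<open>S\<^sub>k\<close> is disjoint from \<open>x - S\<^bsub>n-k\<^esub>\<close>, while any \<open>h\<close> consecutive \<open>S\<^sub>k\<close> almost cover \<open>G\<close>; hence any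
  \<open>h\<close> consecutive \<open>S\<^sub>k\<close> have finite intersection. For \<open>h = 2\<close> this makes \<open>S\<^sub>1, S\<^sub>2\<close> an almost
  partition of \<open>G\<close> which every \<open>b \<in> B\<close> permutes by translation, so \<open>B\<close> lies in a coset of a proper
  subgroup and cannot be a basis. For \<open>h = 3\<close> the same argument applies successively to the sets
  \<open>S\<^sub>k \<inter> S\<^bsub>k+1\<^esub>\<close>, to \<open>S\<^sub>k, S\<^bsub>k+1\<^esub>\<close> if some \<open>S\<^sub>j \<inter> S\<^bsub>j+2\<^esub>\<close> is non-empty, and to \<open>S\<^sub>1, S\<^sub>2, S\<^sub>3\<close>. It gives the
  bounds \<open>4\<close> and \<open>10\<close>.

  Lower bounds: it suffices to find a basis \<open>C\<close> such that \<open>hC\<close> misses infinitely many elements, all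
  of them in \<open>u + (h - 1)C\<close>; then adjoin \<open>u\<close>. If some element has infinite order or order at least
  \<open>8\<close>, let \<open>C\<close> be the preimage of an arc of suitable length under a character of \<open>G\<close>. If
  \<open>G \<noteq> pG\<close> with \<open>p = 5\<close> or \<open>7\<close>, use an arc in \<open>\<int>/p\<close>. Otherwise \<open>12G = 0\<close>, and \<open>G\<close> has a quotient
  \<open>(\<int>/2)\<^sup>4\<close> or \<open>(\<int>/3)\<^sup>2\<close>, where \<open>C\<close> is given explicitly.
\<close>

section \<open>Sumsets\<close>

lemma sumset_fold_0 [simp]: "sumset_fold 0 A = {0}"
  by (auto simp: sumset_fold_def)

lemma sumset_fold_Suc: "sumset_fold (Suc k) A = {x + a | x a. x \<in> sumset_fold k A \<and> a \<in> A}"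
proof (intro equalityI subsetI)
  fix z assume "z \<in> sumset_fold (Suc k) A"
  then obtain x where x: "z = (\<Sum>i<Suc k. x i)" "\<forall>i<Suc k. x i \<in> A"
    by (auto simp: sumset_fold_def)
  then have "(\<Sum>i<k. x i) \<in> sumset_fold k A"
    by (auto simp: sumset_fold_def)
  with x show "z \<in> {x + a | x a. x \<in> sumset_fold k A \<and> a \<in> A}"
    by auto
next
  fix z assume "z \<in> {x + a | x a. x \<in> sumset_fold k A \<and> a \<in> A}"
  then obtain x a where x: "z = (\<Sum>i<k. x i) + a" "\<forall>i<k. x i \<in> A" "a \<in> A"
    by (auto simp: sumset_fold_def)
  then have "z = (\<Sum>i<Suc k. (x(k := a)) i)" "\<forall>i<Suc k. (x(k := a)) i \<in> A"
    by (auto simp: less_Suc_eq)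
  then show "z \<in> sumset_fold (Suc k) A"
    unfolding sumset_fold_def by blast
qed

lemma sumset_fold_1 [simp]: "sumset_fold (Suc 0) A = A"
  by (auto simp: sumset_fold_Suc)

lemma sumset_fold_add:
  "x \<in> sumset_fold i A \<Longrightarrow> y \<in> sumset_fold j A \<Longrightarrow> x + y \<in> sumset_fold (i + j) A"
proof (induction j arbitrary: y)
  case (Suc j)
  then obtain y' a where y: "y = y' + a" "y' \<in> sumset_fold j A" "a \<in> A"
    by (auto simp: sumset_fold_Suc)
  with Suc have "x + y' \<in> sumset_fold (i + j) A" by blast
  with y have "(x + y') + a \<in> sumset_fold (Suc (i + j)) A"
    unfolding sumset_fold_Suc by blast
  then show ?case by (simp add: y add.assoc)
qed simp

lemma sumset_fold_nonempty: "A \<noteq> {} \<Longrightarrow> sumset_fold k A \<noteq> {}"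
  by (induction k) (auto simp: sumset_fold_Suc)

lemma sumset_fold_mono: "A \<subseteq> B \<Longrightarrow> sumset_fold k A \<subseteq> sumset_fold k B"
  unfolding sumset_fold_def by blast

lemma sumset_fold_translate:
  "sumset_fold k ((\<lambda>x. x + c) ` A) = (\<lambda>x. x + (\<Sum>i<k. c)) ` sumset_fold k A"
proof (induction k)
  case (Suc k)
  have "sumset_fold (Suc k) ((\<lambda>x. x + c) ` A) =
      {(x + (\<Sum>i<k. c)) + (a + c) | x a. x \<in> sumset_fold k A \<and> a \<in> A}"
    unfolding sumset_fold_Suc Suc by blast
  also have "\<dots> = {(x + a) + (\<Sum>i<Suc k. c) | x a. x \<in> sumset_fold k A \<and> a \<in> A}"
    by (simp add: algebra_simps)
  also have "\<dots> = (\<lambda>x. x + (\<Sum>i<Suc k. c)) ` sumset_fold (Suc k) A"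
    unfolding sumset_fold_Suc by blast
  finally show ?case .
qed simp

lemma finite_sumset_fold: "finite A \<Longrightarrow> finite (sumset_fold k A)"
proof (induction k)
  case (Suc k)
  have "sumset_fold (Suc k) A = (\<lambda>(x, a). x + a) ` (sumset_fold k A \<times> A)"
    by (auto simp: sumset_fold_Suc)
  with Suc show ?case by simp
qed simp

section \<open>Cofinite sets, translates and bases\<close>

lemma almost_eq_UNIV_iff: "A \<sim> UNIV \<longleftrightarrow> finite (- A)"
  by (simp add: almost_eq_def Compl_eq_Diff_UNIV)

lemma finite_translate_iff:
  "finite ((\<lambda>x. x + c) ` A) \<longleftrightarrow> finite (A :: 'a::ab_group_add set)"
  by (rule finite_image_iff) auto

lemma cofinite_translate_iff:
  "finite (- (\<lambda>x. x + c) ` A) \<longleftrightarrow> finite (- A :: 'a::ab_group_add set)"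
proof -
  have "bij (\<lambda>x. x + c)"
    by (rule bijI) (auto simp: inj_def intro: surjI[of _ "\<lambda>x. x - c"])
  then have "- (\<lambda>x. x + c) ` A = (\<lambda>x. x + c) ` (- A)"
    by (simp add: bij_image_Compl_eq)
  then show ?thesis by (simp add: finite_translate_iff)
qed

lemma ord_star_le:
  "0 < k \<Longrightarrow> finite (- sumset_fold k A) \<Longrightarrow> ord_star A \<le> enat k"
  unfolding ord_star_def almost_eq_UNIV_iff by (rule Inf_lower) auto

lemma is_basis_iff: "is_basis A \<longleftrightarrow> (\<exists>k>0. finite (- sumset_fold k A))"
proof
  assume "is_basis A"
  then have "{enat k | k. k > 0 \<and> sumset_fold k A \<sim> UNIV} \<noteq> {}"
    unfolding is_basis_def ord_star_def by (metis Inf_enat_def less_irrefl)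
  then show "\<exists>k>0. finite (- sumset_fold k A)"
    by (auto simp: almost_eq_UNIV_iff)
next
  assume "\<exists>k>0. finite (- sumset_fold k A)"
  then obtain k where "k > 0" "finite (- sumset_fold k A)" by blast
  then have "ord_star A \<le> enat k" by (rule ord_star_le)
  then show "is_basis A"
    unfolding is_basis_def using order_le_less_trans by fastforce
qed

text \<open>Adding one fixed sum of \<open>n - k\<close> elements of \<open>A\<close> translates the
  \<open>k\<close>-fold sumset into the \<open>n\<close>-fold one.\<close>

lemma cofinite_sumset_fold_mono:
  assumes "finite (- sumset_fold k A)" "k \<le> n" "A \<noteq> {}"
  shows "finite (- sumset_fold n A)"
proof -
  obtain c where c: "c \<in> sumset_fold (n - k) A"
    using sumset_fold_nonempty[OF assms(3)] by blast
  have "(\<lambda>x. x + c) ` sumset_fold k A \<subseteq> sumset_fold n A"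
    using sumset_fold_add[OF _ c, of _ k] assms(2) by auto
  then have "- sumset_fold n A \<subseteq> - (\<lambda>x. x + c) ` sumset_fold k A" by blast
  moreover have "finite (- (\<lambda>x. x + c) ` sumset_fold k A)"
    using assms(1) cofinite_translate_iff[of c "sumset_fold k A"] by simp
  ultimately show ?thesis by (rule finite_subset)
qed

section \<open>Upper bounds\<close>

text \<open>The hypotheses make every \<open>b + P\<close> with \<open>b \<in> B\<close> almost equal to \<open>P'\<close>, so the stabiliser
  of \<open>P\<close> modulo finite sets contains \<open>B - B\<close>. As \<open>B\<close> is a basis it is then all of \<open>G\<close>, whence
  \<open>P\<close> and \<open>P'\<close> are almost equal.\<close>

lemma basis_not_rigid:
  fixes B :: "'a::ab_group_add set"
  assumes inf: "infinite (UNIV :: 'a set)"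
    and basis: "finite (- sumset_fold n B)" and ne: "B \<noteq> {}"
    and P: "\<And>b x. b \<in> B \<Longrightarrow> x \<in> P \<Longrightarrow> x + b \<in> P'"
    and R: "\<And>b x. b \<in> B \<Longrightarrow> x \<in> R \<Longrightarrow> x + b \<in> R'"
    and cov: "finite (- (P \<union> R))" and fin': "finite (P' \<inter> R')"
    and fin: "finite (P \<inter> P')" and infP: "infinite P"
  shows False
proof -
  \<comment> \<open>\<open>?E g\<close> says that \<open>g\<close> stabilises \<open>P\<close>
    modulo finite sets.\<close>
  let ?E = "\<lambda>g. finite {x. (x \<in> P) \<noteq> (x + g \<in> P)}"
  have fin_shift: "finite {x. Q (x + c)}" if "finite {x. Q x}" for Q and c :: 'a
  proof -
    have "{x. Q (x + c)} = (\<lambda>x. x + (- c)) ` {x. Q x}"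
      by (auto simp: image_iff) (metis add_diff_cancel_right')
    with that show ?thesis by simp
  qed
  have fin_shift_set: "finite {x. x + c \<in> X}" if "finite X" for X and c :: 'a
    using fin_shift[of "\<lambda>x. x \<in> X" c] that by simp
  \<comment> \<open>A point outside \<open>P\<close> that \<open>b\<close> moves into
    \<open>P'\<close> either lies outside \<open>P \<union> R\<close>, or lies in \<open>R\<close>
    and lands in \<open>P' \<inter> R'\<close>.\<close>
  have eqP': "finite {x. (x \<in> P) \<noteq> (x + b \<in> P')}" if b: "b \<in> B" for b
  proof -
    have "{x. (x \<in> P) \<noteq> (x + b \<in> P')} \<subseteq> - (P \<union> R) \<union> {x. x + b \<in> P' \<inter> R'}"
      using P[OF b] R[OF b] by auto
    moreover have "finite {x. x + b \<in> P' \<inter> R'}"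
      using fin' by (rule fin_shift_set)
    ultimately show ?thesis using cov finite_subset by blast
  qed
  have E_add: "?E (g + h)" if "?E g" "?E h" for g h
  proof -
    have "{x. (x \<in> P) \<noteq> (x + (g + h) \<in> P)} \<subseteq>
        {x. (x \<in> P) \<noteq> (x + g \<in> P)} \<union> {x. (x + g \<in> P) \<noteq> ((x + g) + h \<in> P)}"
      by (auto simp: add.assoc)
    with that(1) fin_shift[OF that(2), of g] show ?thesis
      by (meson finite_Un finite_subset)
  qed
  have E_B: "?E (b - c)" if "b \<in> B" "c \<in> B" for b c
  proof -
    have "finite {x. ((x - c) \<in> P) \<noteq> (x \<in> P')}" "finite {x. ((x - c) \<in> P) \<noteq> ((x - c) + b \<in> P')}"
      using fin_shift[OF eqP'[OF that(2)], of "- c"] fin_shift[OF eqP'[OF that(1)], of "- c"]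
      by simp_all
    then have *: "finite {x. (x + b - c \<in> P) \<noteq> (x + b \<in> P')}"
      using fin_shift[of "\<lambda>x. ((x - c) \<in> P) \<noteq> (x \<in> P')" b] by simp
    have "{x. (x \<in> P) \<noteq> (x + (b - c) \<in> P)} \<subseteq>
       {x. (x + b - c \<in> P) \<noteq> (x + b \<in> P')} \<union> {x. (x \<in> P) \<noteq> (x + b \<in> P')}"
      by (auto simp: algebra_simps)
    with * eqP'[OF that(1)] show ?thesis
      by (meson finite_Un finite_subset)
  qed
  have E_S: "?E (x - y)" if "x \<in> sumset_fold k B" "y \<in> sumset_fold k B" for x y k
    using that
  proof (induction k arbitrary: x y)
    case (Suc k)
    then obtain x' y' b c where
      "x = x' + b" "y = y' + c" "x' \<in> sumset_fold k B" "y' \<in> sumset_fold k B" "b \<in> B" "c \<in> B"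
      by (auto simp: sumset_fold_Suc)
    with E_add[of "x' - y'" "b - c"] E_B[of b c] Suc.IH[of x' y'] show ?case
      by (simp add: algebra_simps)
  qed simp
  obtain b where b: "b \<in> B" using ne by blast
  \<comment> \<open>The cofinite set \<open>sumset_fold n B\<close> meets its translate by
    \<open>- b\<close>, so \<open>b\<close> itself is a difference of two of its elements.\<close>
  have "finite (- sumset_fold n B \<union> {x. x + b \<in> - sumset_fold n B})"
    using basis fin_shift_set[OF basis, of b] by (rule finite_UnI)
  then obtain x where "x \<in> sumset_fold n B" "x + b \<in> sumset_fold n B"
    using ex_new_if_finite[OF inf] by (metis (no_types, lifting) ComplI UnI1 UnI2 mem_Collect_eq)
  from E_S[OF this(2,1)] have Eb: "?E b" by simp
  \<comment> \<open>All but finitely many points of \<open>P\<close> stay in \<open>P\<close> under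
    \<open>b\<close>, but those that stay land in the finite set
    \<open>P \<inter> P'\<close>.\<close>
  have "P \<subseteq> {x. (x \<in> P) \<noteq> (x + b \<in> P)} \<union> {x. x + b \<in> P \<inter> P'}"
    using P[OF b] by auto
  moreover have "finite {x. x + b \<in> P \<inter> P'}"
    using fin by (rule fin_shift_set)
  ultimately show False using Eb infP by (meson finite_Un finite_subset)
qed

section \<open>Order of a basis whose first sumsets almost cover the group\<close>

lemma basis_infinite:
  fixes B :: "'a::ab_group_add set"
  assumes "infinite (UNIV :: 'a set)" "finite (- sumset_fold n B)"
  shows "infinite B"
proof
  assume "finite B"
  then have "finite (- sumset_fold n B \<union> sumset_fold n B)"
    using assms(2) finite_sumset_fold by blast
  with assms(1) show False by simp
qed

lemma finite_Compl_translate_subset: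
  assumes "finite (- X)" "\<And>x. x \<in> X \<Longrightarrow> x + c \<in> Y"
  shows "finite (- Y :: 'a::ab_group_add set)"
proof (rule finite_subset)
  show "- Y \<subseteq> - (\<lambda>x. x + c) ` X" using assms(2) by blast
  show "finite (- (\<lambda>x. x + c) ` X)" using assms(1) cofinite_translate_iff by blast
qed

text \<open>The injection sending \<open>u\<close> to \<open>x - u\<close> maps \<open>X\<close>
  into the finite complement of \<open>Y\<close>.\<close>

lemma finite_if_sums_avoid:
  fixes x :: "'a::ab_group_add"
  assumes "finite (- Y)" "\<And>u v. u \<in> X \<Longrightarrow> v \<in> Y \<Longrightarrow> u + v \<noteq> x"
  shows "finite X"
proof (rule finite_subset)
  show "X \<subseteq> (\<lambda>v. x - v) ` (- Y)"
  proof
    fix u assume "u \<in> X"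
    then have "x - u \<in> - Y" using assms(2)[of u "x - u"] by auto
    then show "u \<in> (\<lambda>v. x - v) ` (- Y)" by (rule rev_image_eqI) simp
  qed
qed (use assms(1) in simp)

text \<open>If 4B misses \<open>x\<close>, then B \<inter> 2B is finite because its sums with 3B and
  2B lie in 4B, and 2B \<inter> 3B likewise. Now \<open>basis_not_rigid\<close> applies with P = B,
  P' = R = 2B, R' = 3B.\<close>

lemma order_4_of_cover_2:
  fixes B :: "'a::ab_group_add set"
  assumes inf: "infinite (UNIV :: 'a set)"
    and basis: "finite (- sumset_fold n B)"
    and cov: "finite (- (B \<union> sumset_fold 2 B))"
  shows "finite (- sumset_fold 4 B)"
proof (rule ccontr)
  let ?S = "\<lambda>k. sumset_fold k B"
  assume "\<not> ?thesis"
  then obtain x where x: "x \<notin> ?S 4" by (metis ComplD finite.emptyI equals0I)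
  have infB: "infinite B" using basis_infinite[OF inf basis] .
  then obtain b where b: "b \<in> B" by fastforce
  have step: "y + b \<in> ?S (Suc k)" if "y \<in> ?S k" "b \<in> B" for y b k
    using that unfolding sumset_fold_Suc by blast
  have S1: "?S 1 = B" by simp
  have cov2: "finite (- (?S 2 \<union> ?S 3))"
    by (rule finite_Compl_translate_subset[OF cov, of b])
      (use step[OF _ b, of _ 1] step[OF _ b, of _ 2] in \<open>auto simp: numeral_eq_Suc\<close>)
  have not_x: "u + v \<noteq> x" if "u \<in> ?S i" "v \<in> ?S j" "i + j = 4" for u v i j
    using sumset_fold_add[OF that(1,2)] that(3) x by auto
  have 12: "finite (?S 1 \<inter> ?S 2)"
    by (rule finite_if_sums_avoid[OF cov2, of _ x])
      (use not_x[of _ 1 _ 3] not_x[of _ 2 _ 2] in auto)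
  have 23: "finite (?S 2 \<inter> ?S 3)"
    by (rule finite_if_sums_avoid[OF cov, of _ x])
      (use not_x[of _ 3 _ 1] not_x[of _ 2 _ 2] in auto)
  show False
  proof (rule basis_not_rigid[OF inf basis])
    show "B \<noteq> {}" using b by blast
    show "y + c \<in> ?S 2" if "c \<in> B" "y \<in> ?S 1" for c y
      using step[OF that(2,1)] by (simp add: numeral_eq_Suc)
    show "y + c \<in> ?S 3" if "c \<in> B" "y \<in> ?S 2" for c y
      using step[OF that(2,1)] by (simp add: numeral_eq_Suc)
  qed (use cov infB 12 23 in auto)
qed

text \<open>The constant comes from a chain: the final step needs 2B \<inter> 4B empty, which needs
  5B \<inter> 6B empty, which needs 7B \<inter> 8B \<inter> 9B finite, and 7 + 3 = 10. Every link
  after the triple intersections is an application of \<open>basis_not_rigid\<close>.\<close>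

lemma order_10_of_cover_3:
  fixes B :: "'a::ab_group_add set"
  assumes inf: "infinite (UNIV :: 'a set)"
    and basis: "finite (- sumset_fold n B)"
    and cov: "finite (- (B \<union> sumset_fold 2 B \<union> sumset_fold 3 B))"
  shows "finite (- sumset_fold 10 B)"
proof (rule ccontr)
  define S where "S k = sumset_fold k B" for k
  assume "\<not> ?thesis"
  then obtain x where x: "x \<notin> S 10" unfolding S_def by (metis ComplD finite.emptyI equals0I)
  have infB: "infinite B" using basis_infinite[OF inf basis] .
  then have ne: "B \<noteq> {}" by auto
  have step: "y + b \<in> S (Suc k)" if "y \<in> S k" "b \<in> B" for y b k
    using that unfolding S_def sumset_fold_Suc by blast
  have add: "y + z \<in> S k" if "y \<in> S i" "z \<in> S j" "i + j = k" for y z i j k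
    using that sumset_fold_add unfolding S_def by blast
  have infS: "infinite (S (Suc k))" for k
  proof
    assume fin: "finite (S (Suc k))"
    obtain c where "c \<in> S k" using sumset_fold_nonempty[OF ne] unfolding S_def by blast
    then have "(\<lambda>y. y + c) ` B \<subseteq> S (Suc k)" using step by (auto simp: add.commute[of _ c])
    with fin infB show False using finite_subset finite_translate_iff by blast
  qed
  have cover: "finite (- (S (Suc k) \<union> S (k + 2) \<union> S (k + 3)))" for k
  proof -
    obtain c where c: "c \<in> S k" using sumset_fold_nonempty[OF ne] unfolding S_def by blast
    show ?thesis
    proof (rule finite_Compl_translate_subset[OF cov, of c])
      fix y assume "y \<in> B \<union> sumset_fold 2 B \<union> sumset_fold 3 B"
      then have "y \<in> S 1 \<or> y \<in> S 2 \<or> y \<in> S 3" by (simp add: S_def)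
      then show "y + c \<in> S (Suc k) \<union> S (k + 2) \<union> S (k + 3)"
        using add[OF _ c, of y 1 "Suc k"] add[OF _ c, of y 2 "k + 2"] add[OF _ c, of y 3 "k + 3"]
        by auto
    qed
  qed
  have cover1: "finite (- (S 1 \<union> S 2 \<union> S 3))" using cov by (simp add: S_def)
  \<comment> \<open>The indices k, k + 1, k + 2 are paired with 10 - k, 9 - k, 8 - k, so every sum
    lies in \<open>S 10\<close> and avoids \<open>x\<close>. For k \<le> 7 the three partner indices
    are positive, and their sets almost cover the group.\<close>
  have triple: "finite (S k \<inter> S (k + 1) \<inter> S (k + 2))" if "k \<le> 7" for k
  proof (rule finite_if_sums_avoid[OF cover[of "7 - k"], of _ x])
    fix u v assume "u \<in> S k \<inter> S (k + 1) \<inter> S (k + 2)"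
      "v \<in> S (Suc (7 - k)) \<union> S (7 - k + 2) \<union> S (7 - k + 3)"
    with that have "u + v \<in> S 10"
      using add[of u "k + 2" v "Suc (7 - k)" 10] add[of u "k + 1" v "7 - k + 2" 10]
        add[of u k v "7 - k + 3" 10] by auto
    with x show "u + v \<noteq> x" by blast
  qed
  have P_empty: "S k \<inter> S (k + 1) = {}" if "k \<le> 5" for k
  proof (rule ccontr)
    assume "S k \<inter> S (k + 1) \<noteq> {}"
    then obtain p where p: "p \<in> S k" "p \<in> S (k + 1)" by blast
    \<comment> \<open>Translation by \<open>p\<close> carries \<open>S j\<close> into
      \<open>P (k + j)\<close>, so three consecutive sets \<open>P\<close> inherit the almost
      covering.\<close>
    define P where "P m = S m \<inter> S (m + 1)" for m
    have Pstep: "y + b \<in> P (Suc m)" if "b \<in> B" "y \<in> P m" for b y m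
      using that step unfolding P_def by auto
    have shift: "y + p \<in> P (k + j)" if "y \<in> S j" for y j
      using add[OF that p(1)] add[OF that p(2)] by (simp add: P_def add.commute)
    show False
    proof (rule basis_not_rigid[OF inf basis ne])
      show "y + b \<in> P (k + 2)" if "b \<in> B" "y \<in> P (k + 1)" for b y
        using Pstep[OF that] by simp
      show "y + b \<in> P (k + 3) \<union> P (k + 4)" if "b \<in> B" "y \<in> P (k + 2) \<union> P (k + 3)" for b y
        using Pstep[OF that(1), of y] that(2) by (auto simp: numeral_eq_Suc)
      show "finite (- (P (k + 1) \<union> (P (k + 2) \<union> P (k + 3))))"
        by (rule finite_Compl_translate_subset[OF cover1, of p])
          (use shift[of _ 1] shift[of _ 2] shift[of _ 3] in auto)
      \<comment> \<open>Both parts of this intersection lie in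
        \<open>S (k + 2) \<inter> S (k + 3) \<inter> S (k + 4)\<close>; the condition k \<le> 5 is k
        + 2 \<le> 7.\<close>
      show "finite (P (k + 2) \<inter> (P (k + 3) \<union> P (k + 4)))"
        by (rule finite_subset[OF _ triple[of "k + 2"]])
          (use that in \<open>auto simp: P_def numeral_eq_Suc\<close>)
      show "finite (P (k + 1) \<inter> P (k + 2))"
        by (rule finite_subset[OF _ triple[of "k + 1"]])
          (use that in \<open>auto simp: P_def numeral_eq_Suc\<close>)
      have "(\<lambda>y. y + p) ` S (Suc 0) \<subseteq> P (k + 1)" using shift[of _ 1] by auto
      with infS[of 0] show "infinite (P (k + 1))"
        using finite_subset finite_translate_iff by blast
    qed
  qed
  have Q_empty: "S k \<inter> S (k + 2) = {}" if "k \<le> 2" for k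
  proof (rule ccontr)
    assume "S k \<inter> S (k + 2) \<noteq> {}"
    then obtain q where q: "q \<in> S k" "q \<in> S (k + 2)" by blast
    have shift: "y + q \<in> S (k + j)" "y + q \<in> S (k + 2 + j)" if "y \<in> S j" for y j
      using add[OF that q(1)] add[OF that q(2)] by (simp_all add: add.commute)
    show False
    proof (rule basis_not_rigid[OF inf basis ne])
      show "y + b \<in> S (k + 3)" if "b \<in> B" "y \<in> S (k + 2)" for b y
        using step[OF that(2,1)] by (simp add: numeral_eq_Suc)
      show "y + b \<in> S (k + 4)" if "b \<in> B" "y \<in> S (k + 3)" for b y
        using step[OF that(2,1)] by (simp add: numeral_eq_Suc)
      \<comment> \<open>Translation by \<open>q\<close> carries \<open>S 1\<close> and
        \<open>S 3\<close> into \<open>S (k + 3)\<close> and \<open>S 2\<close> into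
        \<open>S (k + 2)\<close>, so two consecutive sumsets already suffice.\<close>
      show "finite (- (S (k + 2) \<union> S (k + 3)))"
        by (rule finite_Compl_translate_subset[OF cover1, of q])
          (use shift(2)[of _ 1] shift(1)[of _ 2] shift(1)[of _ 3] in \<open>auto simp: numeral_eq_Suc\<close>)
      show "finite (S (k + 3) \<inter> S (k + 4))" "finite (S (k + 2) \<inter> S (k + 3))"
        using P_empty[of "k + 3"] P_empty[of "k + 2"] that by (simp_all add: numeral_eq_Suc)
      show "infinite (S (k + 2))" using infS[of "k + 1"] by simp
    qed
  qed
  show False
  proof (rule basis_not_rigid[OF inf basis ne])
    show "y + b \<in> S 2" if "b \<in> B" "y \<in> S 1" for b y
      using step[OF that(2,1)] by (simp add: numeral_eq_Suc)
    show "y + b \<in> S 3 \<union> S 4" if "b \<in> B" "y \<in> S 2 \<union> S 3" for b y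
      using step[OF _ that(1), of y] that(2) by (auto simp: numeral_eq_Suc)
    show "finite (- (S 1 \<union> (S 2 \<union> S 3)))" using cover1 by (simp add: Un_assoc)
    have "S 2 \<inter> S 3 = {}" "S 2 \<inter> S 4 = {}" "S 1 \<inter> S 2 = {}"
      using P_empty[of 1] P_empty[of 2] Q_empty[of 2] by (simp_all add: numeral_eq_Suc)
    then show "finite (S 2 \<inter> (S 3 \<union> S 4))" "finite (S 1 \<inter> S 2)"
      by (simp_all add: Int_Un_distrib)
    show "infinite (S 1)" using infS[of 0] by simp
  qed
qed

section \<open>From \<open>X_G\<close> to covers by sumsets\<close>

lemma sumset_fold_insert_0: "sumset_fold h (insert 0 B) \<subseteq> (\<Union>i\<le>h. sumset_fold i B)"
proof (induction h)
  case (Suc h)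
  show ?case
  proof
    fix z assume "z \<in> sumset_fold (Suc h) (insert 0 B)"
    then obtain y b where z: "z = y + b" "y \<in> sumset_fold h (insert 0 B)" "b \<in> insert 0 B"
      by (auto simp: sumset_fold_Suc)
    with Suc obtain i where i: "i \<le> h" "y \<in> sumset_fold i B" by blast
    show "z \<in> (\<Union>i\<le>Suc h. sumset_fold i B)"
    proof (cases "b = 0")
      case True
      with i z show ?thesis by (auto intro!: bexI[of _ i])
    next
      case False
      with i z have "z \<in> sumset_fold (Suc i) B" by (auto simp: sumset_fold_Suc)
      with i show ?thesis by blast
    qed
  qed
qed simp

text \<open>Translation by \<open>- a\<close> turns \<open>A\<close> into \<open>insert 0 B\<close>
  and preserves cofiniteness of all sumsets. The \<open>h\<close>-fold sumset of
  \<open>insert 0 B\<close> lies in the union of the \<open>i\<close>-fold sumsets of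
  \<open>B\<close> for i \<le> h, and the term i = 0 contributes only the point 0.\<close>

lemma X_G_le:
  fixes N h :: nat
  assumes N: "N > 0"
    and *: "\<And>(B :: 'a::ab_group_add set) n. finite (- sumset_fold n B) \<Longrightarrow>
      finite (- (\<Union>i\<in>{1..h}. sumset_fold i B)) \<Longrightarrow> finite (- sumset_fold N B)"
  shows "X_G TYPE('a) h \<le> enat N"
  unfolding X_G_def
proof (rule Sup_least)
  fix z :: enat
  assume "z \<in> {ord_star (A - {a}) | (A :: 'a set) a.
    sumset_fold h A \<sim> UNIV \<and> a \<in> regular_elements A}"
  then obtain A :: "'a set" and a where z: "z = ord_star (A - {a})"
    and hA: "finite (- sumset_fold h A)" and a: "a \<in> regular_elements A"
    by (auto simp: almost_eq_UNIV_iff)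
  from a obtain n where aA: "a \<in> A" and n: "finite (- sumset_fold n (A - {a}))"
    by (auto simp: regular_elements_def is_basis_iff)
  let ?B = "(\<lambda>x. x + (- a)) ` (A - {a})"
  have cof: "finite (- sumset_fold k ((\<lambda>x. x + (- a)) ` C)) \<longleftrightarrow> finite (- sumset_fold k C)" for k C
    unfolding sumset_fold_translate cofinite_translate_iff ..
  have "(\<lambda>x. x + (- a)) ` A = insert 0 ?B" using aA by auto
  then have "finite (- sumset_fold h (insert 0 ?B))" using hA cof[of h A] by simp
  moreover have "- (\<Union>i\<in>{1..h}. sumset_fold i ?B) \<subseteq> insert 0 (- sumset_fold h (insert 0 ?B))"
  proof
    fix y assume y: "y \<in> - (\<Union>i\<in>{1..h}. sumset_fold i ?B)"
    show "y \<in> insert 0 (- sumset_fold h (insert 0 ?B))"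
    proof (rule ccontr)
      assume "\<not> ?thesis"
      then have "y \<noteq> 0" "y \<in> sumset_fold h (insert 0 ?B)" by auto
      with sumset_fold_insert_0[of h ?B] obtain i where i: "i \<le> h" "y \<in> sumset_fold i ?B" by blast
      with \<open>y \<noteq> 0\<close> have "i \<noteq> 0" by (cases i) auto
      with i y show False by auto
    qed
  qed
  ultimately have "finite (- (\<Union>i\<in>{1..h}. sumset_fold i ?B))"
    by (meson finite.insertI finite_subset)
  with *[of n ?B] n have "finite (- sumset_fold N (A - {a}))"
    by (simp only: cof)
  with N show "z \<le> enat N" unfolding z by (rule ord_star_le)
qed

lemma X_G_2_le:
  assumes "infinite (UNIV :: 'a::ab_group_add set)"
  shows "X_G TYPE('a) 2 \<le> enat 4"
proof (rule X_G_le)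
  fix B :: "'a set" and n
  assume "finite (- sumset_fold n B)" "finite (- (\<Union>i\<in>{1..2}. sumset_fold i B))"
  moreover have "{1..2} = {1, 2 :: nat}" by auto
  ultimately show "finite (- sumset_fold 4 B)"
    using order_4_of_cover_2[OF assms, of n B] by simp
qed simp

lemma X_G_3_le:
  assumes "infinite (UNIV :: 'a::ab_group_add set)"
  shows "X_G TYPE('a) 3 \<le> enat 10"
proof (rule X_G_le)
  fix B :: "'a set" and n
  assume "finite (- sumset_fold n B)" "finite (- (\<Union>i\<in>{1..3}. sumset_fold i B))"
  moreover have "{1..3} = {1, 2, 3 :: nat}" by auto
  ultimately show "finite (- sumset_fold 10 B)"
    using order_10_of_cover_3[OF assms, of n B] by (simp add: Int_assoc)
qed simp

section \<open>Lower bounds\<close>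

text \<open>Take A = \<open>insert u C\<close>. By \<open>cov\<close> the new element fills every
  gap of the sumset with \<open>Suc h\<close> summands, while \<open>C\<close> alone leaves
  infinitely many gaps there and hence at every smaller number of summands. So the order of
  \<open>C\<close> is at least h + 2.\<close>

lemma X_G_ge:
  fixes C :: "'a::ab_group_add set" and u :: 'a
  assumes miss: "infinite (- sumset_fold (Suc h) C)"
    and cov: "\<And>x. x \<notin> sumset_fold (Suc h) C \<Longrightarrow> x - u \<in> sumset_fold h C"
    and basis: "sumset_fold k C = UNIV" "k > 0"
  shows "enat (h + 2) \<le> X_G TYPE('a) (Suc h)"
proof -
  have ne: "C \<noteq> {}"
  proof
    assume "C = {}"
    with basis show False by (cases k) (auto simp: sumset_fold_Suc)
  qed
  \<comment> \<open>If \<open>u\<close> were in \<open>C\<close>, \<open>cov\<close> would close all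
    gaps already. Hence removing \<open>u\<close> from \<open>insert u C\<close> gives back
    \<open>C\<close>.\<close>
  have u: "u \<notin> C"
  proof
    assume "u \<in> C"
    have "x \<in> sumset_fold (Suc h) C" for x
    proof (rule ccontr)
      assume "x \<notin> sumset_fold (Suc h) C"
      with cov have "x - u \<in> sumset_fold h C" by blast
      with \<open>u \<in> C\<close> have "x - u + u \<in> sumset_fold (Suc h) C" unfolding sumset_fold_Suc by blast
      with \<open>x \<notin> sumset_fold (Suc h) C\<close> show False by simp
    qed
    then have "sumset_fold (Suc h) C = UNIV" by blast
    with miss show False by simp
  qed
  have "x \<in> sumset_fold (Suc h) (insert u C)" for x
  proof (cases "x \<in> sumset_fold (Suc h) C")
    case True
    then show ?thesis using sumset_fold_mono[of C "insert u C"] by blast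
  next
    case False
    then have "x - u \<in> sumset_fold h (insert u C)"
      using cov sumset_fold_mono[of C "insert u C" h] by blast
    then have "x - u + u \<in> sumset_fold (Suc h) (insert u C)" unfolding sumset_fold_Suc by blast
    then show ?thesis by simp
  qed
  then have "sumset_fold (Suc h) (insert u C) = UNIV" by blast
  then have A: "sumset_fold (Suc h) (insert u C) \<sim> UNIV" by (simp add: almost_eq_def)
  have "is_basis C" unfolding is_basis_iff using basis by (intro exI[of _ k]) simp
  then have "u \<in> regular_elements (insert u C)" using u by (simp add: regular_elements_def)
  moreover have "insert u C - {u} = C" using u by simp
  ultimately have "ord_star C \<le> X_G TYPE('a) (Suc h)"
    unfolding X_G_def by (intro Sup_upper CollectI exI[of _ "insert u C"] exI[of _ u]) (use A in simp)
  moreover have "enat (h + 2) \<le> ord_star C"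
    unfolding ord_star_def
  proof (rule Inf_greatest)
    fix z assume "z \<in> {enat k |k. 0 < k \<and> sumset_fold k C \<sim> UNIV}"
    then obtain j where z: "z = enat j" "finite (- sumset_fold j C)"
      by (auto simp: almost_eq_UNIV_iff)
    have "\<not> j \<le> Suc h" using cofinite_sumset_fold_mono[OF z(2) _ ne] miss by blast
    with z show "enat (h + 2) \<le> z" by simp
  qed
  ultimately show ?thesis by (rule order_trans[rotated])
qed

subsection \<open>Characters\<close>

definition zmul :: "int \<Rightarrow> 'a::ab_group_add \<Rightarrow> 'a" where
  "zmul k x = (if 0 \<le> k then (\<Sum>i<nat k. x) else - (\<Sum>i<nat (- k). x))"

lemma zmul_0 [simp]: "zmul 0 x = 0"
  by (simp add: zmul_def)

lemma zmul_1 [simp]: "zmul 1 x = x"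
  by (simp add: zmul_def)

lemma zmul_succ: "zmul (k + 1) x = zmul k x + x"
proof (cases "0 \<le> k")
  case True
  then have "nat (k + 1) = Suc (nat k)" by simp
  with True show ?thesis by (simp add: zmul_def)
next
  case False
  then have "nat (- k) = Suc (nat (- (k + 1)))" by simp
  with False show ?thesis by (auto simp: zmul_def)
qed

lemma zmul_pred: "zmul (k - 1) x = zmul k x - x"
  using zmul_succ[of "k - 1" x] by simp

lemma zmul_add_left: "zmul (j + k) x = zmul j x + zmul k x"
proof (induction k rule: int_induct[where k = 0])
  case (step1 k)
  then show ?case using zmul_succ[of "j + k" x] by (simp add: zmul_succ add.assoc)
next
  case (step2 k)
  then show ?case using zmul_pred[of "j + k" x] by (simp add: zmul_pred add_diff_eq)
qed simp

lemma zmul_minus_left: "zmul (- k) x = - zmul k x"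
  using zmul_add_left[of "- k" k x] by (simp add: eq_neg_iff_add_eq_0)

lemma zmul_diff_left: "zmul (j - k) x = zmul j x - zmul k x"
  using zmul_add_left[of j "- k" x] by (simp add: zmul_minus_left)

lemma zmul_add_right: "zmul k (x + y) = zmul k x + zmul k y"
  by (induction k rule: int_induct[where k = 0]) (simp_all add: zmul_succ zmul_pred)

lemma zmul_zero_right [simp]: "zmul k 0 = 0"
  using zmul_add_right[of k 0 0] by simp

lemma zmul_minus_right: "zmul k (- x) = - zmul k x"
  using zmul_add_right[of k "- x" x] by (simp add: eq_neg_iff_add_eq_0)

lemma zmul_diff_right: "zmul k (x - y) = zmul k x - zmul k y"
  using zmul_add_right[of k x "- y"] by (simp add: zmul_minus_right)

lemma zmul_zmul: "zmul j (zmul k x) = zmul (j * k) x"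
  by (induction j rule: int_induct[where k = 0])
    (simp_all add: zmul_succ zmul_pred zmul_add_left zmul_diff_left distrib_right left_diff_distrib)

lemma zmul_Pair: "zmul k (x, y) = (zmul k x, zmul k y)"
  by (induction k rule: int_induct[where k = 0]) (simp_all add: zmul_succ zmul_pred zero_prod_def)

lemma zmul_ring: "zmul k (x :: 'a::ring_1) = of_int k * x"
  by (induction k rule: int_induct[where k = 0])
    (simp_all add: zmul_succ zmul_pred distrib_right left_diff_distrib)

section \<open>Subgroups, cyclic extensions and extension of characters\<close>

definition add_subgroup :: "'a::ab_group_add set \<Rightarrow> bool" where
  "add_subgroup H \<longleftrightarrow> 0 \<in> H \<and> (\<forall>x\<in>H. \<forall>y\<in>H. x - y \<in> H)"

lemma add_subgroup_zero: "add_subgroup H \<Longrightarrow> 0 \<in> H"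
  by (simp add: add_subgroup_def)

lemma add_subgroup_diff: "add_subgroup H \<Longrightarrow> x \<in> H \<Longrightarrow> y \<in> H \<Longrightarrow> x - y \<in> H"
  by (simp add: add_subgroup_def)

lemma add_subgroup_minus: "add_subgroup H \<Longrightarrow> x \<in> H \<Longrightarrow> - x \<in> H"
  using add_subgroup_diff[of H 0 x] add_subgroup_zero[of H] by simp

lemma add_subgroup_add: "add_subgroup H \<Longrightarrow> x \<in> H \<Longrightarrow> y \<in> H \<Longrightarrow> x + y \<in> H"
  using add_subgroup_diff[of H x "- y"] add_subgroup_minus[of H y] by simp

lemma add_subgroup_zmul: "add_subgroup H \<Longrightarrow> x \<in> H \<Longrightarrow> zmul k x \<in> H"
  by (induction k rule: int_induct[where k = 0])
    (auto simp: zmul_succ zmul_pred add_subgroup_zero add_subgroup_add add_subgroup_diff)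

lemma add_subgroup_extend:
  assumes "add_subgroup H"
  shows "add_subgroup {x + zmul k g | x k. x \<in> H}"
  unfolding add_subgroup_def
proof safe
  show "\<exists>x k. 0 = x + zmul k g \<and> x \<in> H"
    by (rule exI[of _ 0], rule exI[of _ 0]) (simp add: assms add_subgroup_zero)
next
  fix x y j k assume "x \<in> H" "y \<in> H"
  then show "\<exists>z i. x + zmul j g - (y + zmul k g) = z + zmul i g \<and> z \<in> H"
    by (intro exI[of _ "x - y"] exI[of _ "j - k"])
      (simp add: assms add_subgroup_diff zmul_diff_left)
qed

text \<open>Division with remainder by the least positive element. The trivial subgroup gives n = 0,
  which later stands for infinite order.\<close>

lemma int_subgroup_generator:
  fixes T :: "int set"
  assumes T: "add_subgroup T"
  obtains n where "n \<ge> 0" "n \<in> T" "\<And>k. k \<in> T \<Longrightarrow> n dvd k"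
proof (cases "\<exists>k\<in>T. k > 0")
  case False
  have "k = 0" if "k \<in> T" for k
    using False that add_subgroup_minus[OF T that] by (metis linorder_neqE neg_0_less_iff_less)
  then show ?thesis using that[of 0] add_subgroup_zero[OF T] by auto
next
  case True
  define n where "n = (LEAST n::nat. n > 0 \<and> int n \<in> T)"
  have ex: "\<exists>n::nat. n > 0 \<and> int n \<in> T"
    using True by (metis zero_less_imp_eq_int)
  have n: "n > 0" "int n \<in> T" using LeastI_ex[OF ex] unfolding n_def by auto
  have "int n dvd k" if "k \<in> T" for k
  proof -
    have "k mod int n = k - zmul (k div int n) (int n)"
      by (simp add: zmul_ring minus_div_mult_eq_mod)
    then have "k mod int n \<in> T"
      using add_subgroup_diff[OF T that add_subgroup_zmul[OF T n(2)]] by metis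
    moreover have "k mod int n \<ge> 0" "k mod int n < int n" using n(1) by simp_all
    ultimately have "nat (k mod int n) = 0"
      using not_less_Least[of "nat (k mod int n)" "\<lambda>n. n > 0 \<and> int n \<in> T"]
      unfolding n_def[symmetric] by (auto simp: nat_less_iff)
    then show ?thesis using \<open>k mod int n \<ge> 0\<close> by (simp add: dvd_eq_mod_eq_0)
  qed
  then show ?thesis using that[of "int n"] n by auto
qed

text \<open>Homomorphisms to \<open>\<real>/\<int>\<close> are represented by real-valued functions that are additive modulo
  integers. As \<open>\<real>/\<int>\<close> is divisible, a maximal subgroup of \<open>G \<times> \<real>\<close> whose fibre over \<open>0\<close> is integral
  projects onto \<open>G\<close>, so it is the graph of such a homomorphism.\<close>

lemma character_exists:
  fixes g :: "'a::ab_group_add" and m :: nat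
  assumes H: "add_subgroup H" and m: "m > 0"
    and order: "\<And>k. zmul k g \<in> H \<Longrightarrow> int m dvd k"
  obtains \<chi> :: "'a \<Rightarrow> real" where
    "\<And>x y. \<chi> (x + y) - \<chi> x - \<chi> y \<in> \<int>" "\<And>x. x \<in> H \<Longrightarrow> \<chi> x \<in> \<int>" "\<chi> g - 1 / m \<in> \<int>"
proof -
  \<comment> \<open>The subgroup generated by \<open>H \<times> \<int>\<close> and the pair
    prescribing 1/m at \<open>g\<close>. Its fibre over 0 is integral because a multiple k of
    \<open>g\<close> lies in \<open>H\<close> only if m divides k.\<close>
  define \<Gamma>0 :: "('a \<times> real) set" where
    "\<Gamma>0 = {v + zmul k (g, 1 / m) | v k. v \<in> H \<times> \<int>}"
  have "add_subgroup (H \<times> (\<int> :: real set))"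
    using H by (auto simp: add_subgroup_def zero_prod_def)
  then have sub0: "add_subgroup \<Gamma>0"
    unfolding \<Gamma>0_def by (rule add_subgroup_extend)
  have fib0: "r \<in> \<int>" if "(0, r) \<in> \<Gamma>0" for r
  proof -
    from that obtain a t k where at: "a \<in> H" "t \<in> \<int>" "a + zmul k g = 0" "r = t + of_int k / m"
      by (auto simp: \<Gamma>0_def zmul_Pair zmul_ring)
    then have "zmul k g = - a" by (simp add: eq_neg_iff_add_eq_0 add.commute)
    with at(1) order[of k] add_subgroup_minus[OF H] have "int m dvd k" by auto
    then obtain j where "k = int m * j" by blast
    then show ?thesis using at m by simp
  qed
  define \<A> where "\<A> = {\<Gamma> :: ('a \<times> real) set. add_subgroup \<Gamma> \<and> \<Gamma>0 \<subseteq> \<Gamma> \<and> (\<forall>r. (0, r) \<in> \<Gamma> \<longrightarrow> r \<in> \<int>)}"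
  have "\<exists>M\<in>\<A>. \<forall>X\<in>\<A>. M \<subseteq> X \<longrightarrow> X = M"
  proof (rule subset_Zorn_nonempty)
    show "\<A> \<noteq> {}" using sub0 fib0 unfolding \<A>_def by blast
    fix \<C> assume \<C>: "\<C> \<noteq> {}" "subset.chain \<A> \<C>"
    have "x - y \<in> \<Union>\<C>" if xy: "x \<in> \<Union>\<C>" "y \<in> \<Union>\<C>" for x y
    proof -
      obtain X Y where XY: "X \<in> \<C>" "Y \<in> \<C>" "x \<in> X" "y \<in> Y" using xy by blast
      with \<C> have "X \<subseteq> Y \<or> Y \<subseteq> X" by (auto simp: subset_chain_def)
      then obtain Z where "Z \<in> \<C>" "x \<in> Z" "y \<in> Z" using XY by blast
      moreover from this have "add_subgroup Z" using \<C> unfolding \<A>_def subset_chain_def by blast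
      ultimately show ?thesis using add_subgroup_diff by blast
    qed
    moreover obtain X where "X \<in> \<C>" "X \<in> \<A>" using \<C> by (auto simp: subset_chain_def)
    ultimately show "\<Union>\<C> \<in> \<A>"
      using \<C> unfolding \<A>_def subset_chain_def
      by (auto simp: add_subgroup_def)
  qed
  then obtain \<Gamma> where \<Gamma>: "\<Gamma> \<in> \<A>" and max: "\<And>X. X \<in> \<A> \<Longrightarrow> \<Gamma> \<subseteq> X \<Longrightarrow> X = \<Gamma>" by blast
  from \<Gamma> have sub: "add_subgroup \<Gamma>" and le: "\<Gamma>0 \<subseteq> \<Gamma>" and fib: "\<And>r. (0, r) \<in> \<Gamma> \<Longrightarrow> r \<in> \<int>"
    unfolding \<A>_def by auto
  have total: "\<exists>r. (y, r) \<in> \<Gamma>" for y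
  proof -
    \<comment> \<open>\<open>T\<close> consists of the integers k for which the multiple of
      \<open>y\<close> by k already has a partner in \<open>\<Gamma>\<close>; its generator
      determines how to extend.\<close>
    define T where "T = {k. \<exists>s. (zmul k y, s) \<in> \<Gamma>}"
    have "add_subgroup T"
      unfolding add_subgroup_def
    proof (intro conjI ballI)
      show "0 \<in> T" using add_subgroup_zero[OF sub] by (auto simp: T_def zero_prod_def)
      fix j k assume "j \<in> T" "k \<in> T"
      then obtain s t where "(zmul j y, s) \<in> \<Gamma>" "(zmul k y, t) \<in> \<Gamma>" by (auto simp: T_def)
      from add_subgroup_diff[OF sub this] show "j - k \<in> T"
        by (auto simp: T_def zmul_diff_left)
    qed
    then obtain n where n: "n \<in> T" "\<And>k. k \<in> T \<Longrightarrow> n dvd k"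
      using int_subgroup_generator by metis
    then obtain s where s: "(zmul n y, s) \<in> \<Gamma>" by (auto simp: T_def)
    \<comment> \<open>Chosen so that n times (y, r) is the known element of \<open>\<Gamma>\<close>.
      If n = 0, then \<open>T\<close> is trivial and division by zero gives the admissible value r =
      0.\<close>
    define r where "r = s / of_int n"
    have mult: "zmul k (y, r) \<in> \<Gamma>" if k: "k \<in> T" for k
    proof (cases "n = 0")
      case True
      with n(2)[OF k] show ?thesis using add_subgroup_zero[OF sub] by simp
    next
      case False
      from n(2)[OF k] obtain j where j: "k = n * j" by blast
      then have "zmul k (y, r) = zmul j (zmul n y, s)"
        using False by (simp add: zmul_Pair zmul_ring zmul_zmul r_def mult.commute)
      then show ?thesis using add_subgroup_zmul[OF sub s] by simp
    qed
    define X where "X = {v + zmul k (y, r) | v k. v \<in> \<Gamma>}"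
    have subX: "add_subgroup X" unfolding X_def by (rule add_subgroup_extend[OF sub])
    have \<Gamma>X: "\<Gamma> \<subseteq> X"
    proof
      fix v assume "v \<in> \<Gamma>"
      then show "v \<in> X" unfolding X_def by (intro CollectI exI[of _ v] exI[of _ 0]) simp
    qed
    \<comment> \<open>A point of \<open>X\<close> over 0 uses a multiple k in \<open>T\<close>, so
      its second summand already lies in \<open>\<Gamma>\<close> and no new point over 0
      arises.\<close>
    have "t \<in> \<int>" if "(0, t) \<in> X" for t
    proof -
      from that obtain v k where v: "v \<in> \<Gamma>" "(0, t) = v + zmul k (y, r)" by (auto simp: X_def)
      obtain a c where ac: "v = (a, c)" by force
      have "- a = zmul k y" using v(2) ac by (simp add: zmul_Pair neg_eq_iff_add_eq_0)
      then have "(zmul k y, - c) \<in> \<Gamma>" using add_subgroup_minus[OF sub v(1)] ac by simp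
      then have "k \<in> T" by (auto simp: T_def)
      from add_subgroup_add[OF sub v(1) mult[OF this]] show ?thesis using v(2) fib by simp
    qed
    then have "X \<in> \<A>" using subX \<Gamma>X le unfolding \<A>_def by blast
    then have "X = \<Gamma>" using max \<Gamma>X by blast
    moreover have "0 + zmul 1 (y, r) \<in> X"
      using add_subgroup_zero[OF sub] unfolding X_def by blast
    ultimately show ?thesis by auto
  qed
  define \<chi> where "\<chi> y = (SOME r. (y, r) \<in> \<Gamma>)" for y
  have \<chi>: "(y, \<chi> y) \<in> \<Gamma>" for y unfolding \<chi>_def using someI_ex[OF total] .
  have uniq: "s - t \<in> \<int>" if "(y, s) \<in> \<Gamma>" "(y, t) \<in> \<Gamma>" for y s t
    using add_subgroup_diff[OF sub that] fib by simp
  show ?thesis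
  proof
    show "\<chi> (x + y) - \<chi> x - \<chi> y \<in> \<int>" for x y
      using uniq[OF \<chi>[of "x + y"], of "\<chi> x + \<chi> y"] add_subgroup_add[OF sub \<chi>[of x] \<chi>[of y]]
      by (simp add: algebra_simps)
    show "\<chi> x \<in> \<int>" if "x \<in> H" for x
    proof -
      have "(x, 0) + zmul 0 (g, 1 / m) \<in> \<Gamma>0" using that unfolding \<Gamma>0_def by (metis (mono_tags, lifting) CollectI Ints_0 SigmaI)
      with le uniq[OF \<chi>[of x], of 0] show ?thesis by auto
    qed
    have "(0, 0) + zmul 1 (g, 1 / m) \<in> \<Gamma>0"
      using add_subgroup_zero[OF H] unfolding \<Gamma>0_def
      by (metis (mono_tags, lifting) CollectI Ints_0 SigmaI)
    with le uniq[OF \<chi>[of g], of "1 / m"] show "\<chi> g - 1 / m \<in> \<int>" by auto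
  qed
qed

section \<open>Preimages of arcs of the circle\<close>

definition circle_hom :: "('a::ab_group_add \<Rightarrow> real) \<Rightarrow> bool" where
  "circle_hom \<chi> \<longleftrightarrow> (\<forall>x y. \<chi> (x + y) - \<chi> x - \<chi> y \<in> \<int>)"

lemma circle_hom_diff:
  assumes "circle_hom \<chi>"
  shows "\<chi> (x - y) - (\<chi> x - \<chi> y) \<in> \<int>"
proof -
  have "\<chi> ((x - y) + y) - \<chi> (x - y) - \<chi> y \<in> \<int>" using assms unfolding circle_hom_def by blast
  from Ints_minus[OF this] show ?thesis by (simp add: algebra_simps)
qed

lemma circle_hom_zmul:
  assumes "circle_hom \<chi>"
  shows "\<chi> (zmul k x) - of_int k * \<chi> x \<in> \<int>"
proof (induction k rule: int_induct[where k = 0])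
  case base
  show ?case using circle_hom_diff[OF assms, of 0 0] by simp
next
  case (step1 k)
  have "\<chi> (zmul k x + x) - \<chi> (zmul k x) - \<chi> x \<in> \<int>" using assms unfolding circle_hom_def by blast
  from Ints_add[OF this step1(2)] show ?case by (simp add: zmul_succ add.commute[of 1] distrib_right del: add_diff_eq) (simp add: algebra_simps)
next
  case (step2 k)
  from Ints_add[OF circle_hom_diff[OF assms, of "zmul k x" x] step2(2)]
  show ?case by (simp add: zmul_pred algebra_simps)
qed

text \<open>Quantifying over a representative \<open>r\<close> lets \<open>s\<close> be 1 or more,
  in which case the set is the whole group.\<close>

definition arc :: "('a::ab_group_add \<Rightarrow> real) \<Rightarrow> real \<Rightarrow> 'a set" where
  "arc \<chi> s = {x. \<exists>r. 0 \<le> r \<and> r \<le> s \<and> \<chi> x - r \<in> \<int>}"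

text \<open>The element \<open>c\<close> attains the right endpoint of the arc: a value above
  \<open>s\<close> is lowered by subtracting \<open>c\<close>, and a value up to \<open>s\<close> is
  itself a summand, with 0 for the others. This works even if the values of \<open>\<chi>\<close>
  are not dense.\<close>

lemma sumset_fold_arc:
  fixes s :: real
  assumes hom: "circle_hom \<chi>" and s: "0 \<le> s" "\<chi> c - s \<in> \<int>"
  shows "sumset_fold (Suc k) (arc \<chi> s) = arc \<chi> (Suc k * s)"
proof (induction k)
  case (Suc k)
  show ?case
  proof (intro equalityI subsetI)
    fix z assume "z \<in> sumset_fold (Suc (Suc k)) (arc \<chi> s)"
    then obtain x y where z: "z = x + y" "x \<in> arc \<chi> (Suc k * s)" "y \<in> arc \<chi> s"
      unfolding sumset_fold_Suc[of "Suc k"] Suc by blast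
    then obtain r t where rt: "0 \<le> r" "r \<le> Suc k * s" "\<chi> x - r \<in> \<int>" "0 \<le> t" "t \<le> s" "\<chi> y - t \<in> \<int>"
      by (auto simp: arc_def)
    have "\<chi> (x + y) - \<chi> x - \<chi> y \<in> \<int>" using hom unfolding circle_hom_def by blast
    from Ints_add[OF Ints_add[OF this rt(3)] rt(6)] have "\<chi> z - (r + t) \<in> \<int>"
      by (simp add: z algebra_simps)
    with rt show "z \<in> arc \<chi> (Suc (Suc k) * s)"
      unfolding arc_def by (intro CollectI exI[of _ "r + t"]) (simp add: algebra_simps)
  next
    fix z assume "z \<in> arc \<chi> (Suc (Suc k) * s)"
    then obtain r where r: "0 \<le> r" "r \<le> Suc (Suc k) * s" "\<chi> z - r \<in> \<int>" by (auto simp: arc_def)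
    have "\<exists>y. y \<in> arc \<chi> s \<and> z - y \<in> arc \<chi> (Suc k * s)"
    proof (cases "r \<le> s")
      case True
      have "\<chi> 0 \<in> \<int>" using circle_hom_diff[OF hom, of 0 0] by simp
      then have "0 \<in> arc \<chi> (Suc k * s)" unfolding arc_def using s by (intro CollectI exI[of _ 0]) simp
      with True r show ?thesis by (intro exI[of _ z]) (auto simp: arc_def)
    next
      case False
      have "c \<in> arc \<chi> s" unfolding arc_def using s by blast
      moreover have "\<chi> (z - c) - (r - s) \<in> \<int>"
        using Ints_add[OF circle_hom_diff[OF hom, of z c] Ints_diff[OF r(3) s(2)]]
        by (simp add: algebra_simps)
      then have "z - c \<in> arc \<chi> (Suc k * s)"
        unfolding arc_def using r False
        by (intro CollectI exI[of _ "r - s"]) (simp add: algebra_simps)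
      ultimately show ?thesis by blast
    qed
    then obtain y where y: "y \<in> arc \<chi> s" "z - y \<in> sumset_fold (Suc k) (arc \<chi> s)"
      unfolding Suc by blast
    then have "(z - y) + y \<in> sumset_fold (Suc (Suc k)) (arc \<chi> s)"
      unfolding sumset_fold_Suc[of "Suc k"] by blast
    then show "z \<in> sumset_fold (Suc (Suc k)) (arc \<chi> s)" by simp
  qed
qed simp

text \<open>On a circle of length m, let \<open>C\<close> be the preimage of [0, l]. The sumset with
  \<open>Suc h\<close> summands covers [0, (h + 1) l], and \<open>cov\<close> puts what is left
  inside [w, w + h l], which is the \<open>h\<close>-fold sumset moved by \<open>w\<close> times
  \<open>g\<close>.\<close>

lemma X_G_ge_of_character:
  fixes \<chi> :: "'a::ab_group_add \<Rightarrow> real" and h l m w :: nat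
  assumes inf: "infinite (UNIV :: 'a set)" and hom: "circle_hom \<chi>" and g: "\<chi> g - 1 / m \<in> \<int>"
    and h: "h > 0" and l: "l > 0" "Suc h * l + 2 \<le> m"
    and cov: "\<And>x (r :: real). \<chi> x - r \<in> \<int> \<Longrightarrow> r < 1 \<Longrightarrow> real (Suc h * l) < m * r \<Longrightarrow>
      real w \<le> m * r \<and> m * r \<le> real (w + h * l)"
  shows "enat (h + 2) \<le> X_G TYPE('a) (Suc h)"
proof -
  have m: "m > 0" using l by simp
  have multiple: "\<chi> (zmul (int j) g) - j / m \<in> \<int>" for j
    using Ints_add[OF circle_hom_zmul[OF hom, of "int j" g] Ints_mult[OF Ints_of_nat[of j] g]] m
    by (simp add: field_simps)
  have frac: "\<chi> x - frac (\<chi> x) \<in> \<int>" for x by (simp add: frac_def)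
  let ?C = "arc \<chi> (l / m)"
  have fold: "sumset_fold (Suc k) ?C = arc \<chi> (real (Suc k * l) / m)" for k
    using sumset_fold_arc[OF hom _ multiple[of l], of k] by (simp only: of_nat_mult times_divide_eq_right) simp
  show ?thesis
  proof (rule X_G_ge)
    let ?M = "- sumset_fold (Suc h) ?C"
    \<comment> \<open>A suitable multiple of \<open>g\<close> moves \<open>x\<close> to a value in
      [1 - 1/m, 1), beyond the end of the arc, which is at most 1 - 2/m. So finitely many translates
      of the missed set cover the group.\<close>
    have "\<exists>j<m. x + zmul (int j) g \<in> ?M" for x
    proof -
      define r where "r = frac (\<chi> x)"
      have r: "0 \<le> r" "r < 1" unfolding r_def by (simp_all add: frac_lt_1)
      define i where "i = nat \<lfloor>m * r\<rfloor>"
      have i: "real i \<le> m * r" "m * r < real i + 1" using r unfolding i_def by (simp_all; linarith)+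
      have "m * r < m" using r m by simp
      with i have im: "i < m" by linarith
      define j where "j = m - 1 - i"
      have jr: "real j = real m - 1 - real i" unfolding j_def using im m by (simp add: of_nat_diff)
      have "x + zmul (int j) g \<notin> arc \<chi> (real (Suc h * l) / m)"
      proof
        assume "x + zmul (int j) g \<in> arc \<chi> (real (Suc h * l) / m)"
        then obtain t where t: "0 \<le> t" "t \<le> real (Suc h * l) / m" "\<chi> (x + zmul (int j) g) - t \<in> \<int>"
          by (auto simp: arc_def)
        have "\<chi> (x + zmul (int j) g) - \<chi> x - \<chi> (zmul (int j) g) \<in> \<int>"
          using hom unfolding circle_hom_def by blast
        from Ints_diff[OF t(3) Ints_add[OF Ints_add[OF this multiple[of j]] frac[of x]]]
        have "r + j / m - t \<in> \<int>" by (simp add: r_def algebra_simps)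
        moreover have "0 \<le> m * t" using t(1) by simp
        then have "m * (r + j / m - t) < m * 1"
          using i jr m by (simp add: algebra_simps)
        then have "r + j / m - t < 1" using m by simp
        moreover have "m * t \<le> real (Suc h * l)" using t(2) m by (simp add: field_simps)
        then have "m * t + 2 \<le> m" using l(2) by linarith
        then have "0 < m * (r + j / m - t)"
          using i jr m by (simp add: algebra_simps)
        then have "0 < r + j / m - t" using m by (simp add: zero_less_mult_iff)
        ultimately show False by (metis Ints_cases int_one_le_iff_zero_less not_less of_int_0_less_iff of_int_less_1_iff)
      qed
      moreover have "j < m" unfolding j_def using m by simp
      ultimately show ?thesis unfolding fold by blast
    qed
    then have "UNIV \<subseteq> (\<Union>j<m. (\<lambda>y. y - zmul (int j) g) ` ?M)"
      by (force simp: image_iff)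
    then show "infinite ?M" using inf by (meson finite_UN_I finite_imageI finite_lessThan finite_subset)
  next
    fix x assume "x \<notin> sumset_fold (Suc h) ?C"
    then have x: "x \<notin> arc \<chi> (real (Suc h * l) / m)" unfolding fold .
    let ?r = "frac (\<chi> x)"
    have "\<not> ?r \<le> real (Suc h * l) / m" using x frac[of x] by (auto simp: arc_def)
    then have "real (Suc h * l) < m * ?r" using m by (simp add: field_simps)
    with cov[OF frac frac_lt_1] have b: "real w \<le> m * ?r" "m * ?r \<le> real (w + h * l)" by auto
    obtain h' where h': "h = Suc h'" using h by (cases h) auto
    have "\<chi> (x - zmul (int w) g) - (?r - w / m) \<in> \<int>"
      using Ints_add[OF circle_hom_diff[OF hom, of x "zmul (int w) g"] Ints_diff[OF frac[of x] multiple[of w]]]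
      by (simp add: algebra_simps)
    moreover have "0 \<le> ?r - w / m" "?r - w / m \<le> h * l / m"
      using b m by (simp_all add: le_diff_eq diff_le_eq divide_le_eq mult.commute flip: add_divide_distrib)
        (simp add: le_divide_eq mult.commute)
    ultimately have "x - zmul (int w) g \<in> arc \<chi> (real (Suc h' * l) / m)"
      unfolding arc_def h' by blast
    then show "x - zmul (int w) g \<in> sumset_fold h ?C" unfolding h' fold .
  next
    have "x \<in> arc \<chi> (real (Suc (m - 1) * l) / m)" for x
    proof -
      have "1 \<le> real (Suc (m - 1) * l) / m" using m l by simp
      then have "frac (\<chi> x) \<le> real (Suc (m - 1) * l) / m" using frac_lt_1[of "\<chi> x"] by linarith
      then show ?thesis unfolding arc_def using frac[of x] by (intro CollectI exI[of _ "frac (\<chi> x)"]) simp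
    qed
    then show "sumset_fold (Suc (m - 1)) ?C = UNIV" unfolding fold by blast
  qed simp
qed

text \<open>The gap from (h + 1) l to m has length at most h l, so \<open>w\<close> can be its left
  end.\<close>

lemma X_G_ge_of_wide_arc:
  fixes \<chi> :: "'a::ab_group_add \<Rightarrow> real" and h l m :: nat
  assumes "infinite (UNIV :: 'a set)" "circle_hom \<chi>" "\<chi> g - 1 / m \<in> \<int>"
    and "h > 0" "l > 0" "Suc h * l + 2 \<le> m" and l: "m \<le> (2 * h + 1) * l"
  shows "enat (h + 2) \<le> X_G TYPE('a) (Suc h)"
proof (rule X_G_ge_of_character[where w = "Suc h * l", OF assms(1-6)])
  fix x :: 'a and r :: real
  assume r: "r < 1" "real (Suc h * l) < m * r"
  have "m * r \<le> m" using r(1) by (simp add: mult_left_le)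
  moreover have "real m \<le> real ((2 * h + 1) * l)" using l by (simp only: of_nat_le_iff)
  ultimately show "real (Suc h * l) \<le> m * r \<and> m * r \<le> real (Suc h * l + h * l)"
    using r by (simp add: algebra_simps)
qed

text \<open>The values of \<open>\<chi>\<close> are multiples of 1/m, so the gap consists of the
  residues from (h + 1) l + 1 to m - 1. Starting \<open>w\<close> at the first of them allows m to
  exceed (2 h + 1) l by 2.\<close>

lemma X_G_ge_of_cyclic:
  fixes \<chi> :: "'a::ab_group_add \<Rightarrow> real" and h l m :: nat
  assumes "infinite (UNIV :: 'a set)" "circle_hom \<chi>" "\<chi> g - 1 / m \<in> \<int>"
    and "h > 0" "l > 0" "Suc h * l + 2 \<le> m" and l: "m \<le> (2 * h + 1) * l + 2"
    and cyclic: "\<And>x. m * \<chi> x \<in> \<int>"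
  shows "enat (h + 2) \<le> X_G TYPE('a) (Suc h)"
proof (rule X_G_ge_of_character[where w = "Suc h * l + 1", OF assms(1-6)])
  fix x :: 'a and r :: real
  assume r: "\<chi> x - r \<in> \<int>" "r < 1" "real (Suc h * l) < m * r"
  have "m * \<chi> x - m * (\<chi> x - r) \<in> \<int>"
    using Ints_diff[OF cyclic[of x] Ints_mult[OF Ints_of_nat[of m] r(1)]] .
  then have "m * r \<in> \<int>" by (simp add: algebra_simps)
  then obtain i where i: "m * r = of_int i" by (auto elim: Ints_cases)
  have "m > 0" using assms(6) by simp
  then have "m * r < m" using r(2) by simp
  then have "i < int m" "int (Suc h * l) < i" using i r(3) by linarith+
  moreover have "int m \<le> int ((2 * h + 1) * l + 2)" using l by (simp only: of_nat_le_iff)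
  ultimately have "int (Suc h * l + 1) \<le> i" "i \<le> int (Suc h * l + 1 + h * l)"
    by (simp_all add: algebra_simps)
  then show "real (Suc h * l + 1) \<le> m * r \<and> m * r \<le> real (Suc h * l + 1 + h * l)"
    unfolding i by linarith
qed

subsection \<open>Finite quotients\<close>

text \<open>The form \<open>Suc k\<close> matters: with no summands the left side would be {0} and
  the right side the kernel.\<close>

lemma sumset_fold_vimage:
  fixes \<pi> :: "'a::ab_group_add \<Rightarrow> 'f::ab_group_add"
  assumes "additive \<pi>" "surj \<pi>"
  shows "sumset_fold (Suc k) (\<pi> -` S) = \<pi> -` sumset_fold (Suc k) S"
proof (induction k)
  case (Suc k)
  interpret additive \<pi> by fact
  show ?case
  proof (intro equalityI subsetI)
    fix x assume "x \<in> sumset_fold (Suc (Suc k)) (\<pi> -` S)"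
    then obtain y z where "x = y + z" "\<pi> y \<in> sumset_fold (Suc k) S" "\<pi> z \<in> S"
      unfolding sumset_fold_Suc[of "Suc k"] Suc by blast
    then show "x \<in> \<pi> -` sumset_fold (Suc (Suc k)) S"
      unfolding sumset_fold_Suc[of "Suc k"] by (auto simp: add)
  next
    fix x assume "x \<in> \<pi> -` sumset_fold (Suc (Suc k)) S"
    then obtain y s where "\<pi> x = y + s" "y \<in> sumset_fold (Suc k) S" "s \<in> S"
      unfolding sumset_fold_Suc[of "Suc k"] by blast
    moreover obtain z where "\<pi> z = s" using assms(2) by (metis surjD)
    ultimately have "x - z \<in> sumset_fold (Suc k) (\<pi> -` S)" "z \<in> \<pi> -` S"
      unfolding Suc by (auto simp: diff)
    then have "(x - z) + z \<in> sumset_fold (Suc (Suc k)) (\<pi> -` S)"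
      unfolding sumset_fold_Suc[of "Suc k"] by blast
    then show "x \<in> sumset_fold (Suc (Suc k)) (\<pi> -` S)" by simp
  qed
qed simp

text \<open>Gaps in the finite quotient lift to gaps in the group, and the fibre over
  \<open>v\<close> is infinite because finitely many of its translates cover the group.\<close>

lemma X_G_ge_of_quotient:
  fixes \<pi> :: "'a::ab_group_add \<Rightarrow> 'f::ab_group_add" and S :: "'f set"
  assumes inf: "infinite (UNIV :: 'a set)" and \<pi>: "additive \<pi>" "surj \<pi>"
    and fin: "finite (UNIV :: 'f set)"
    and miss: "v \<notin> sumset_fold (Suc (Suc h)) S"
    and cov: "\<And>x. x \<notin> sumset_fold (Suc (Suc h)) S \<Longrightarrow> x - u \<in> sumset_fold (Suc h) S"
    and basis: "\<And>x. x \<in> sumset_fold (Suc k) S"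
  shows "enat (Suc h + 2) \<le> X_G TYPE('a) (Suc (Suc h))"
proof -
  interpret additive \<pi> by fact
  note fold = sumset_fold_vimage[OF \<pi>]
  define t where "t y = (SOME x. \<pi> x = y)" for y
  have t: "\<pi> (t y) = y" for y unfolding t_def by (rule someI_ex) (use \<pi>(2) in \<open>metis surjD\<close>)
  show ?thesis
  proof (rule X_G_ge)
    have "x \<in> (\<lambda>z. z + t (\<pi> x - v)) ` (\<pi> -` {v})" for x
      by (rule rev_image_eqI[of "x - t (\<pi> x - v)"]) (simp_all add: diff t)
    then have "UNIV \<subseteq> (\<Union>y. (\<lambda>z. z + t y) ` (\<pi> -` {v}))" by blast
    then have "infinite (\<pi> -` {v})"
      using inf fin by (meson finite_UN_I finite_imageI finite_subset)
    moreover have "\<pi> -` {v} \<subseteq> - sumset_fold (Suc (Suc h)) (\<pi> -` S)"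
      using miss unfolding fold by auto
    ultimately show "infinite (- sumset_fold (Suc (Suc h)) (\<pi> -` S))"
      using finite_subset by blast
    show "x - t u \<in> sumset_fold (Suc h) (\<pi> -` S)"
      if "x \<notin> sumset_fold (Suc (Suc h)) (\<pi> -` S)" for x
      using cov[of "\<pi> x"] that unfolding fold by (simp add: diff t)
    show "sumset_fold (Suc k) (\<pi> -` S) = UNIV"
      unfolding fold using basis by auto
  qed simp
qed

section \<open>Explicit sets in the quotients of exponent 2 and 3\<close>

lemma sumset_fold_Suc_iff: "x \<in> sumset_fold (Suc k) S \<longleftrightarrow> (\<exists>s\<in>S. x - s \<in> sumset_fold k S)"
  unfolding sumset_fold_Suc by (force simp: algebra_simps)

lemma sum_mem_sumset_fold:
  assumes "a \<in> S" "b \<in> S"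
  shows "a + b \<in> sumset_fold (Suc (Suc 0)) S"
    and "c \<in> S \<Longrightarrow> a + b + c \<in> sumset_fold (Suc (Suc (Suc 0))) S"
    and "c \<in> S \<Longrightarrow> d \<in> S \<Longrightarrow> a + b + c + d \<in> sumset_fold (Suc (Suc (Suc (Suc 0)))) S"
proof -
  show 2: "a + b \<in> sumset_fold (Suc (Suc 0)) S"
    using assms unfolding sumset_fold_Suc[of "Suc 0"] sumset_fold_1 by blast
  show 3: "a + b + c \<in> sumset_fold (Suc (Suc (Suc 0))) S" if "c \<in> S"
    using 2 that unfolding sumset_fold_Suc[of "Suc (Suc 0)"] by blast
  show "a + b + c + d \<in> sumset_fold (Suc (Suc (Suc (Suc 0)))) S" if "c \<in> S" "d \<in> S"
    using 3 that unfolding sumset_fold_Suc[of "Suc (Suc (Suc 0))"] by blast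
qed

lemma cases_2: obtains "x = (0 :: 2)" | "x = 1"
proof -
  obtain z :: int where z: "x = of_int z" "0 \<le> z" "z < 2" by (rule bit0_cases[of x]) auto
  then have "z = 0 \<or> z = 1" by auto
  then show ?thesis using that z(1) by auto
qed

lemma cases_3: obtains "x = (0 :: 3)" | "x = 1" | "x = 2"
proof -
  obtain z :: int where z: "x = of_int z" "0 \<le> z" "z < 3" by (rule bit1_cases[of x]) auto
  then have "z = 0 \<or> z = 1 \<or> z = 2" by auto
  then show ?thesis using that z(1) by auto
qed

text \<open>\<open>S\<close> consists of 0 and the four unit vectors, so its \<open>k\<close>-fold
  sumset for k \<ge> 1 is the set of vectors with at most k ones. Adding the all-ones vector
  \<open>?u\<close> complements the coordinates: at least three ones become at most one, and four
  become none.\<close>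

lemma X_G_ge_of_quotient_2:
  fixes \<pi> :: "'a::ab_group_add \<Rightarrow> ((2 \<times> 2) \<times> 2) \<times> 2"
  assumes inf: "infinite (UNIV :: 'a set)" and \<pi>: "additive \<pi>" "surj \<pi>"
  shows "enat 3 \<le> X_G TYPE('a) 2" "enat 4 \<le> X_G TYPE('a) 3"
proof -
  define S :: "(((2 \<times> 2) \<times> 2) \<times> 2) set" where
    "S = {(((0, 0), 0), 0), (((1, 0), 0), 0), (((0, 1), 0), 0), (((0, 0), 1), 0), (((0, 0), 0), 1)}"
  let ?u = "(((1, 1), 1), 1) :: ((2 \<times> 2) \<times> 2) \<times> 2"
  have axes: "(((a, 0), 0), 0) \<in> S" "(((0, a), 0), 0) \<in> S" "(((0, 0), a), 0) \<in> S"
    "(((0, 0), 0), a) \<in> S" for a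
    by (cases a rule: cases_2; simp add: S_def)+
  note sum = sum_mem_sumset_fold[where S = S]
  \<comment> \<open>\<open>sumset_fold_Suc_iff\<close> reduces non-membership to a finite check over
    \<open>S\<close>.\<close>
  have miss2: "?u \<notin> sumset_fold (Suc (Suc 0)) S"
    and miss3: "?u \<notin> sumset_fold (Suc (Suc (Suc 0))) S"
    by (simp_all add: sumset_fold_Suc_iff S_def zero_prod_def)
  have cov2: "x - ?u \<in> sumset_fold (Suc 0) S" if "x \<notin> sumset_fold (Suc (Suc 0)) S" for x
  proof -
    obtain a b c d where x: "x = (((a, b), c), d)" by (metis surj_pair)
    have "a \<noteq> 0 \<or> b \<noteq> 0" "a \<noteq> 0 \<or> c \<noteq> 0" "a \<noteq> 0 \<or> d \<noteq> 0"
      "b \<noteq> 0 \<or> c \<noteq> 0" "b \<noteq> 0 \<or> d \<noteq> 0" "c \<noteq> 0 \<or> d \<noteq> 0"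
      using that sum(1)[OF axes(3)[of c] axes(4)[of d]] sum(1)[OF axes(2)[of b] axes(4)[of d]]
        sum(1)[OF axes(2)[of b] axes(3)[of c]] sum(1)[OF axes(1)[of a] axes(4)[of d]]
        sum(1)[OF axes(1)[of a] axes(3)[of c]] sum(1)[OF axes(1)[of a] axes(2)[of b]]
      by (auto simp: x)
    then show ?thesis
      by (cases a rule: cases_2; cases b rule: cases_2; cases c rule: cases_2;
          cases d rule: cases_2; simp add: x axes zero_prod_def)
  qed
  have cov3: "x - ?u \<in> sumset_fold (Suc (Suc 0)) S" if "x \<notin> sumset_fold (Suc (Suc (Suc 0))) S" for x
  proof -
    obtain a b c d where x: "x = (((a, b), c), d)" by (metis surj_pair)
    have "a \<noteq> 0" "b \<noteq> 0" "c \<noteq> 0" "d \<noteq> 0"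
      using that sum(2)[OF axes(2)[of b] axes(3)[of c] axes(4)[of d]]
        sum(2)[OF axes(1)[of a] axes(3)[of c] axes(4)[of d]]
        sum(2)[OF axes(1)[of a] axes(2)[of b] axes(4)[of d]]
        sum(2)[OF axes(1)[of a] axes(2)[of b] axes(3)[of c]]
      by (auto simp: x)
    then have "a = 1" "b = 1" "c = 1" "d = 1"
      by (cases a rule: cases_2, simp_all) (cases b rule: cases_2, simp_all,
          cases c rule: cases_2, simp_all, cases d rule: cases_2, simp_all)
    then have "x = ?u" by (simp add: x)
    then show ?thesis using sum(1)[OF axes(1)[of 0] axes(1)[of 0]] by (simp add: zero_prod_def)
  qed
  have basis: "x \<in> sumset_fold (Suc (Suc (Suc (Suc 0)))) S" for x
  proof -
    obtain a b c d where x: "x = (((a, b), c), d)" by (metis surj_pair)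
    show ?thesis
      using sum(3)[OF axes(1)[of a] axes(2)[of b] axes(3)[of c] axes(4)[of d]] by (simp add: x)
  qed
  show "enat 3 \<le> X_G TYPE('a) 2"
    using X_G_ge_of_quotient[OF inf \<pi> _ miss2 cov2 basis] by (simp add: numeral_eq_Suc)
  show "enat 4 \<le> X_G TYPE('a) 3"
    using X_G_ge_of_quotient[OF inf \<pi> _ miss3 cov3 basis] by (simp add: numeral_eq_Suc)
qed

lemma X_G_ge_of_quotient_3:
  fixes \<pi> :: "'a::ab_group_add \<Rightarrow> 3 \<times> 3"
  assumes inf: "infinite (UNIV :: 'a set)" and \<pi>: "additive \<pi>" "surj \<pi>"
  shows "enat 3 \<le> X_G TYPE('a) 2" "enat 4 \<le> X_G TYPE('a) 3"
proof -
  note sum = sum_mem_sumset_fold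
  show "enat 3 \<le> X_G TYPE('a) 2"
  proof -
    \<comment> \<open>Two summands give the rows 0 and 1 and only one point of row 2; subtracting
      (0, 2) moves row 2 onto row 0, which lies in \<open>S\<close>.\<close>
    define S :: "(3 \<times> 3) set" where "S = {(0, 0), (1, 0), (2, 0), (0, 1)}"
    have miss: "(1, 2) \<notin> sumset_fold (Suc (Suc 0)) S"
      by (simp add: sumset_fold_Suc_iff S_def zero_prod_def)
    have row: "(a, 0) \<in> S" for a by (cases a rule: cases_3) (simp_all add: S_def)
    have one: "(0, 1) \<in> S" by (simp add: S_def)
    have cov: "x - (0, 2) \<in> sumset_fold (Suc 0) S" if "x \<notin> sumset_fold (Suc (Suc 0)) S" for x
    proof -
      obtain a b where x: "x = (a, b)" by force
      have "b \<noteq> 0" "b \<noteq> 1"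
        using that sum(1)[OF row[of a] row[of 0]] sum(1)[OF row[of a] one] by (auto simp: x)
      then have "b = 2" using cases_3 by metis
      then show ?thesis using row[of a] by (simp add: x)
    qed
    have basis: "x \<in> sumset_fold (Suc (Suc (Suc 0))) S" for x
    proof -
      obtain a b where x: "x = (a, b)" by force
      show ?thesis
        using sum(2)[OF row[of a] row[of 0] row[of 0]] sum(2)[OF row[of a] row[of 0] one]
          sum(2)[OF row[of a] one one]
        by (cases b rule: cases_3) (simp_all add: x)
    qed
    show ?thesis
      using X_G_ge_of_quotient[OF inf \<pi> _ miss cov basis] by (simp add: numeral_eq_Suc)
  qed
  show "enat 4 \<le> X_G TYPE('a) 3"
  proof -
    \<comment> \<open>With coordinates taken in 0, 1, 2, a point needs as many unit vectors as its
      coordinate sum. Three summands miss only (2, 2), which is also the element to adjoin.\<close>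
    define S :: "(3 \<times> 3) set" where "S = {(0, 0), (1, 0), (0, 1)}"
    have S: "(0, 0) \<in> S" "(1, 0) \<in> S" "(0, 1) \<in> S" by (simp_all add: S_def)
    have miss: "(2, 2) \<notin> sumset_fold (Suc (Suc (Suc 0))) S"
      by (simp add: sumset_fold_Suc_iff S_def zero_prod_def)
    have row: "(a, 0) \<in> sumset_fold (Suc (Suc 0)) S" for a
      using sum(1)[OF S(1,1)] sum(1)[OF S(2,1)] sum(1)[OF S(2,2)]
      by (cases a rule: cases_3) simp_all
    have col: "(0, a) \<in> sumset_fold (Suc (Suc 0)) S" for a
      using sum(1)[OF S(1,1)] sum(1)[OF S(3,1)] sum(1)[OF S(3,3)]
      by (cases a rule: cases_3) simp_all
    have row1: "(a, 0) \<in> sumset_fold (Suc 0) S" "(0, a) \<in> sumset_fold (Suc 0) S" if "a \<noteq> 2" for a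
      using that S by (cases a rule: cases_3; simp)+
    have cov: "x - (2, 2) \<in> sumset_fold (Suc (Suc 0)) S"
      if "x \<notin> sumset_fold (Suc (Suc (Suc 0))) S" for x
    proof -
      obtain a b where x: "x = (a, b)" by force
      have "a = 2" using that sumset_fold_add[OF row1(1)[of a] col[of b]] by (auto simp: x)
      moreover have "b = 2" using that sumset_fold_add[OF row1(2)[of b] row[of a]] by (auto simp: x)
      ultimately show ?thesis using row[of 0] by (simp add: x zero_prod_def)
    qed
    have basis: "x \<in> sumset_fold (Suc (Suc (Suc (Suc 0)))) S" for x
    proof -
      obtain a b where x: "x = (a, b)" by force
      show ?thesis using sumset_fold_add[OF row[of a] col[of b]] by (simp add: x)
    qed
    show ?thesis
      using X_G_ge_of_quotient[OF inf \<pi> _ miss cov basis] by (simp add: numeral_eq_Suc)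
  qed
qed

section \<open>Functionals modulo a prime and elementary quotients\<close>

lemma add_subgroup_range_zmul: "add_subgroup (range (zmul k))"
  unfolding add_subgroup_def by (auto simp flip: zmul_diff_right) (metis rangeI zmul_zero_right)

lemma circle_hom_times:
  assumes "circle_hom \<chi>" "\<chi> (zmul (int n) x) \<in> \<int>"
  shows "n * \<chi> x \<in> \<int>"
  using Ints_diff[OF assms(2) circle_hom_zmul[OF assms(1), of "int n" x]] by simp

text \<open>By Bezout, if p did not divide k, \<open>e\<close> would be a combination of its
  multiples by p and k, both in \<open>H\<close>. This supplies the order condition of
  \<open>character_exists\<close>.\<close>

lemma zmul_prime_dvd:
  assumes H: "add_subgroup H" and p: "prime (p :: nat)" and pH: "\<And>x. zmul (int p) x \<in> H"
    and e: "e \<notin> H" and k: "zmul k e \<in> H"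
  shows "int p dvd k"
proof (rule ccontr)
  assume "\<not> int p dvd k"
  with p have "coprime (int p) k" by (simp add: prime_imp_coprime)
  then obtain u v where uv: "u * int p + v * k = 1"
    by (metis bezout_int coprime_imp_gcd_eq_1)
  have "zmul (u * int p + v * k) e = zmul u (zmul (int p) e) + zmul v (zmul k e)"
    by (simp add: zmul_add_left zmul_zmul)
  also have "\<dots> \<in> H"
    by (intro add_subgroup_add add_subgroup_zmul H pH k)
  finally show False using e uv by simp
qed

text \<open>A character trivial on \<open>H\<close> takes values in multiples of 1/p. Multiplied by
  p they are integers well defined modulo p, hence elements of a ring in which p vanishes; the floor
  only reads off this integer.\<close>

lemma mod_p_functional_exists:
  fixes H :: "'a::ab_group_add set"
  assumes H: "add_subgroup H" and p: "prime (p :: nat)" and pH: "\<And>x. zmul (int p) x \<in> H"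
    and e: "e \<notin> H" and char: "(of_nat p :: 'f::comm_ring_1) = 0"
  obtains \<phi> :: "'a \<Rightarrow> 'f::comm_ring_1" where "additive \<phi>" "\<And>x. x \<in> H \<Longrightarrow> \<phi> x = 0" "\<phi> e = 1"
proof -
  have p0: "p > 0" using p by (rule prime_gt_0_nat)
  obtain \<chi> :: "'a \<Rightarrow> real" where \<chi>: "\<And>x y. \<chi> (x + y) - \<chi> x - \<chi> y \<in> \<int>"
      "\<And>x. x \<in> H \<Longrightarrow> \<chi> x \<in> \<int>" "\<chi> e - 1 / p \<in> \<int>"
    by (rule character_exists[OF H p0 zmul_prime_dvd[OF H p pH e]]) blast+
  have "circle_hom \<chi>" using \<chi>(1) by (simp add: circle_hom_def)
  then have "p * \<chi> x \<in> \<int>" for x using \<chi>(2)[OF pH] by (rule circle_hom_times)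
  then have i: "p * \<chi> x = of_int \<lfloor>p * \<chi> x\<rfloor>" for x by (metis Ints_cases floor_of_int)
  define \<phi> where "\<phi> x = (of_int \<lfloor>p * \<chi> x\<rfloor> :: 'f)" for x
  have char': "of_int (k + int p * n) = (of_int k :: 'f)" for k n
    using char by simp
  show ?thesis
  proof
    show "additive \<phi>"
    proof
      fix x y
      obtain n where "\<chi> (x + y) - \<chi> x - \<chi> y = of_int n" using \<chi>(1) by (metis Ints_cases)
      then have "p * \<chi> (x + y) = p * \<chi> x + p * \<chi> y + p * of_int n"
        by (simp flip: distrib_left)
      then have "p * \<chi> (x + y) = of_int (\<lfloor>p * \<chi> x\<rfloor> + \<lfloor>p * \<chi> y\<rfloor> + int p * n)"
        using i[of x] i[of y] by simp
      then have "\<lfloor>p * \<chi> (x + y)\<rfloor> = \<lfloor>p * \<chi> x\<rfloor> + \<lfloor>p * \<chi> y\<rfloor> + int p * n"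
        by (metis floor_of_int)
      then show "\<phi> (x + y) = \<phi> x + \<phi> y" unfolding \<phi>_def by (simp only: char') simp
    qed
    show "\<phi> x = 0" if x: "x \<in> H" for x
    proof -
      obtain n where "\<chi> x = of_int n" using \<chi>(2)[OF x] by (metis Ints_cases)
      then have "p * \<chi> x = of_int (0 + int p * n)" by simp
      then show ?thesis unfolding \<phi>_def by (simp only: floor_of_int char') simp
    qed
    obtain n where "\<chi> e - 1 / p = of_int n" using \<chi>(3) by (metis Ints_cases)
    then have "\<chi> e = 1 / p + of_int n" by simp
    then have "p * \<chi> e = of_int (1 + int p * n)" using p0 by (simp add: distrib_left)
    then show "\<phi> e = 1" unfolding \<phi>_def by (simp only: floor_of_int char') simp
  qed
qed

text \<open>\<open>pG \<subseteq> H\<close> and \<open>H/pG\<close> is finite.\<close>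

definition finite_over :: "nat \<Rightarrow> 'a::ab_group_add set \<Rightarrow> bool" where
  "finite_over p H \<longleftrightarrow> (\<forall>x. zmul (int p) x \<in> H) \<and>
    (\<exists>T. finite T \<and> (\<forall>x\<in>H. \<exists>y. \<exists>t\<in>T. x = zmul (int p) y + t))"

text \<open>Dividing k by p leaves one of p remainders, so p times as many representatives
  suffice.\<close>

lemma finite_over_extend:
  assumes "finite_over p H" "p > 0"
  shows "finite_over p {x + zmul k e | x k. x \<in> H}"
proof -
  obtain T where T: "finite T" "\<And>x. x \<in> H \<Longrightarrow> \<exists>y. \<exists>t\<in>T. x = zmul (int p) y + t"
    using assms(1) unfolding finite_over_def by blast
  let ?T = "(\<lambda>(t, i). t + zmul i e) ` (T \<times> {0..<int p})"
  have "\<exists>y. \<exists>t\<in>?T. x + zmul k e = zmul (int p) y + t" if x: "x \<in> H" for x k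
  proof -
    obtain y t where yt: "t \<in> T" "x = zmul (int p) y + t" using T(2)[OF x] by blast
    have "zmul k e = zmul (int p * (k div int p) + k mod int p) e" by simp
    also have "\<dots> = zmul (int p) (zmul (k div int p) e) + zmul (k mod int p) e"
      by (simp only: zmul_add_left zmul_zmul)
    finally have "x + zmul k e
        = zmul (int p) (y + zmul (k div int p) e) + (t + zmul (k mod int p) e)"
      by (simp add: yt zmul_add_right algebra_simps)
    moreover have "t + zmul (k mod int p) e \<in> ?T"
      using yt assms(2) by (force simp: image_iff)
    ultimately show ?thesis by blast
  qed
  moreover have "finite ?T" using T(1) by simp
  moreover have "zmul (int p) x = zmul (int p) x + zmul 0 e" for x by simp
  then have "\<exists>y k. zmul (int p) x = y + zmul k e \<and> y \<in> H" for x
    using assms(1) unfolding finite_over_def by blast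
  ultimately show ?thesis unfolding finite_over_def by blast
qed

text \<open>\<open>H\<close> is finite over the multiples of p and the whole group is not, so some
  \<open>e\<close> lies outside \<open>H\<close>. The new subgroup is generated by \<open>H\<close>
  and \<open>e\<close> and stays finite over these multiples, so the step can be repeated.\<close>

lemma functional_extension:
  fixes H :: "'a::ab_group_add set"
  assumes H: "add_subgroup H" and fo: "finite_over p H" and p: "prime p"
    and char: "(of_nat p :: 'f::comm_ring_1) = 0" and surj: "\<And>a :: 'f::comm_ring_1. \<exists>k. a = of_int k"
    and big: "\<not> finite_over p (UNIV :: 'a set)"
  obtains H' and \<phi> :: "'a \<Rightarrow> 'f::comm_ring_1" where "add_subgroup H'" "finite_over p H'" "additive \<phi>"
    "\<And>x. x \<in> H \<Longrightarrow> \<phi> x = 0"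
    "\<And>a. \<exists>e. \<phi> e = a \<and> (\<forall>x\<in>H. x + e \<in> H')"
proof -
  have "H \<noteq> UNIV" using fo big by blast
  then obtain e where e: "e \<notin> H" by blast
  obtain \<phi> :: "'a \<Rightarrow> 'f" where \<phi>: "additive \<phi>" "\<And>x. x \<in> H \<Longrightarrow> \<phi> x = 0" "\<phi> e = 1"
    by (rule mod_p_functional_exists[OF H p _ e char]) (use fo in \<open>auto simp: finite_over_def\<close>)
  interpret additive \<phi> by fact
  have mult: "\<phi> (zmul k e) = of_int k" for k
    by (induction k rule: int_induct[where k = 0]) (simp_all add: zmul_succ zmul_pred add diff zero \<phi>(3))
  show ?thesis
  proof (rule that[OF add_subgroup_extend[OF H, of e] finite_over_extend[OF fo] \<phi>(1,2)])
    show "p > 0" using p by (rule prime_gt_0_nat)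
    fix a :: 'f
    obtain k where "a = of_int k" using surj by blast
    then have "\<phi> (zmul k e) = a" by (simp add: mult)
    then show "\<exists>e'. \<phi> e' = a \<and> (\<forall>x\<in>H. x + e' \<in> {x + zmul k e |x k. x \<in> H})" by blast
  qed
qed

text \<open>For surjectivity onto the pairs, first hit the new coordinate by some \<open>e\<close>,
  then correct the old one by an element of \<open>H\<close>, where the new functional
  vanishes.\<close>

lemma quotient_step:
  fixes H :: "'a::ab_group_add set" and \<pi> :: "'a \<Rightarrow> 'q::ab_group_add"
  assumes H: "add_subgroup H" "finite_over p H" and p: "prime p"
    and char: "(of_nat p :: 'f::comm_ring_1) = 0" and surj: "\<And>a :: 'f::comm_ring_1. \<exists>k. a = of_int k"
    and big: "\<not> finite_over p (UNIV :: 'a set)"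
    and \<pi>: "additive \<pi>" "\<pi> ` H = UNIV"
  obtains H' and \<pi>' :: "'a \<Rightarrow> 'q \<times> 'f::comm_ring_1" where "add_subgroup H'" "finite_over p H'"
    "additive \<pi>'" "\<pi>' ` H' = UNIV"
proof -
  obtain H' and \<phi> :: "'a \<Rightarrow> 'f" where H': "add_subgroup H'" "finite_over p H'"
    and \<phi>: "additive \<phi>" "\<And>x. x \<in> H \<Longrightarrow> \<phi> x = 0" "\<And>a. \<exists>e. \<phi> e = a \<and> (\<forall>x\<in>H. x + e \<in> H')"
    by (rule functional_extension[OF H p char surj big]) blast
  have add: "additive (\<lambda>x. (\<pi> x, \<phi> x))"
    using \<pi>(1) \<phi>(1) by (simp add: additive_def)
  have "(q, a) \<in> (\<lambda>x. (\<pi> x, \<phi> x)) ` H'" for q a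
  proof -
    obtain e where e: "\<phi> e = a" "\<forall>x\<in>H. x + e \<in> H'" using \<phi>(3) by blast
    have "q - \<pi> e \<in> \<pi> ` H" using \<pi>(2) by simp
    then obtain x where x: "x \<in> H" "\<pi> x = q - \<pi> e" by force
    then have "(\<pi> (x + e), \<phi> (x + e)) = (q, a)"
      using e \<phi>(2)[of x] additive.add[OF \<pi>(1)] additive.add[OF \<phi>(1)] by simp
    with e(2) x(1) show ?thesis by (auto intro!: rev_image_eqI[of "x + e"])
  qed
  then have "(\<lambda>x. (\<pi> x, \<phi> x)) ` H' = UNIV" by auto
  with that[OF H' add] show ?thesis .
qed

lemma quotient_start:
  assumes p: "prime p"
    and char: "(of_nat p :: 'f::comm_ring_1) = 0" and surj: "\<And>a :: 'f::comm_ring_1. \<exists>k. a = of_int k"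
    and big: "\<not> finite_over p (UNIV :: 'a::ab_group_add set)"
  obtains H :: "'a::ab_group_add set" and \<pi> :: "'a \<Rightarrow> 'f::comm_ring_1" where "add_subgroup H" "finite_over p H"
    "additive \<pi>" "\<pi> ` H = UNIV"
proof -
  let ?H = "range (zmul (int p)) :: 'a set"
  note sub = add_subgroup_range_zmul[of "int p"]
  have "finite_over p ?H"
    unfolding finite_over_def by (intro conjI exI[of _ "{0}"]) auto
  then obtain H' and \<phi> :: "'a \<Rightarrow> 'f" where H': "add_subgroup H'" "finite_over p H'"
    and \<phi>: "additive \<phi>" "\<And>a. \<exists>e. \<phi> e = a \<and> (\<forall>x\<in>?H. x + e \<in> H')"
    by (rule functional_extension[OF sub _ p char surj big]) blast
  have "a \<in> \<phi> ` H'" for a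
    using \<phi>(2)[of a] add_subgroup_zero[OF sub] by (metis add_0 imageI)
  then have "\<phi> ` H' = UNIV" by blast
  with that[OF H' \<phi>(1)] show ?thesis .
qed

lemma of_int_surj_2: "\<exists>k. a = (of_int k :: 2)"
  by (cases a rule: cases_2) (metis of_int_0 of_int_1)+

lemma of_int_surj_3: "\<exists>k. a = (of_int k :: 3)"
  by (cases a rule: cases_3) (metis of_int_0 of_int_1 of_int_numeral)+

lemma X_G_ge_of_not_finite_over_2:
  assumes inf: "infinite (UNIV :: 'a::ab_group_add set)"
    and big: "\<not> finite_over 2 (UNIV :: 'a set)"
  shows "enat 3 \<le> X_G TYPE('a) 2" "enat 4 \<le> X_G TYPE('a) 3"
proof -
  have char: "(of_nat 2 :: 2) = 0" by simp
  note step = quotient_step[OF _ _ two_is_prime_nat char of_int_surj_2 big]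
  obtain H1 and \<pi>1 :: "'a \<Rightarrow> 2" where 1: "add_subgroup H1" "finite_over 2 H1" "additive \<pi>1" "\<pi>1 ` H1 = UNIV"
    by (rule quotient_start[OF two_is_prime_nat char of_int_surj_2 big])
  obtain H2 and \<pi>2 :: "'a \<Rightarrow> 2 \<times> 2" where 2: "add_subgroup H2" "finite_over 2 H2" "additive \<pi>2" "\<pi>2 ` H2 = UNIV"
    by (rule step[OF 1])
  obtain H3 and \<pi>3 :: "'a \<Rightarrow> (2 \<times> 2) \<times> 2" where 3: "add_subgroup H3" "finite_over 2 H3" "additive \<pi>3" "\<pi>3 ` H3 = UNIV"
    by (rule step[OF 2])
  obtain H4 and \<pi>4 :: "'a \<Rightarrow> ((2 \<times> 2) \<times> 2) \<times> 2" where 4: "additive \<pi>4" "\<pi>4 ` H4 = UNIV"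
    by (rule step[OF 3])
  have "surj \<pi>4" using 4(2) by blast
  with X_G_ge_of_quotient_2[OF inf 4(1)]
  show "enat 3 \<le> X_G TYPE('a) 2" "enat 4 \<le> X_G TYPE('a) 3" by blast+
qed

lemma X_G_ge_of_not_finite_over_3:
  assumes inf: "infinite (UNIV :: 'a::ab_group_add set)"
    and big: "\<not> finite_over 3 (UNIV :: 'a set)"
  shows "enat 3 \<le> X_G TYPE('a) 2" "enat 4 \<le> X_G TYPE('a) 3"
proof -
  have p: "prime (3 :: nat)" by simp
  have char: "(of_nat 3 :: 3) = 0" by simp
  obtain H1 and \<pi>1 :: "'a \<Rightarrow> 3" where 1: "add_subgroup H1" "finite_over 3 H1" "additive \<pi>1" "\<pi>1 ` H1 = UNIV"
    by (rule quotient_start[OF p char of_int_surj_3 big])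
  obtain H2 and \<pi>2 :: "'a \<Rightarrow> 3 \<times> 3" where 2: "additive \<pi>2" "\<pi>2 ` H2 = UNIV"
    by (rule quotient_step[OF 1(1,2) p char of_int_surj_3 big 1(3,4)])
  have "surj \<pi>2" using 2(2) by blast
  with X_G_ge_of_quotient_3[OF inf 2(1)]
  show "enat 3 \<le> X_G TYPE('a) 2" "enat 4 \<le> X_G TYPE('a) 3" by blast+
qed

subsection \<open>Reduction by element orders\<close>

text \<open>The divisibility form of \<open>order\<close> covers both exact order m and infinite
  order, where any m may be used.\<close>

lemma X_G_ge_of_large_order:
  fixes g :: "'a::ab_group_add"
  assumes inf: "infinite (UNIV :: 'a set)"
    and m: "m \<ge> 8" and order: "\<And>k. zmul k g = 0 \<Longrightarrow> int m dvd k"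
  shows "enat 3 \<le> X_G TYPE('a) 2" "enat 4 \<le> X_G TYPE('a) 3"
proof -
  have "add_subgroup {0 :: 'a}" by (simp add: add_subgroup_def)
  then obtain \<chi> :: "'a \<Rightarrow> real" where hom: "\<And>x y. \<chi> (x + y) - \<chi> x - \<chi> y \<in> \<int>" and g: "\<chi> g - 1 / m \<in> \<int>"
    by (rule character_exists[of "{0}" m g]) (use m order in auto)
  have hom: "circle_hom \<chi>" using hom by (simp add: circle_hom_def)
  \<comment> \<open>The witness is m/3 rounded up, and below m/5 rounded up. For m = 7 no l
    satisfies the inequalities, hence the threshold 8.\<close>
  obtain l where "l > 0" "2 * l + 2 \<le> m" "m \<le> 3 * l"
    by (rule that[of "(m + 2) div 3"]) (use m in presburger)+
  then have "enat (1 + 2) \<le> X_G TYPE('a) (Suc 1)"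
    by (intro X_G_ge_of_wide_arc[OF inf hom g]) auto
  then show "enat 3 \<le> X_G TYPE('a) 2" by (simp add: numeral_eq_Suc)
  obtain l where "l > 0" "3 * l + 2 \<le> m" "m \<le> 5 * l"
    by (rule that[of "(m + 4) div 5"]) (use m in presburger)+
  then have "enat (2 + 2) \<le> X_G TYPE('a) (Suc 2)"
    by (intro X_G_ge_of_wide_arc[OF inf hom g]) auto
  then show "enat 4 \<le> X_G TYPE('a) 3" by (simp add: numeral_eq_Suc)
qed

text \<open>The character is trivial on multiples of p, so its values are multiples of 1/p and the
  sharper discrete estimate applies.\<close>

lemma X_G_ge_of_not_divisible:
  fixes g :: "'a::ab_group_add"
  assumes inf: "infinite (UNIV :: 'a set)"
    and p: "p = 5 \<or> p = 7" and g: "g \<notin> range (zmul (int p))"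
  shows "enat 3 \<le> X_G TYPE('a) 2" "enat 4 \<le> X_G TYPE('a) 3"
proof -
  let ?H = "range (zmul (int p)) :: 'a set"
  have prime: "prime p" using p by auto
  note sub = add_subgroup_range_zmul[of "int p"]
  obtain \<chi> :: "'a \<Rightarrow> real" where \<chi>: "\<And>x y. \<chi> (x + y) - \<chi> x - \<chi> y \<in> \<int>"
      "\<And>x. x \<in> ?H \<Longrightarrow> \<chi> x \<in> \<int>" and g1: "\<chi> g - 1 / p \<in> \<int>"
    by (rule character_exists[OF sub prime_gt_0_nat[OF prime] zmul_prime_dvd[OF sub prime rangeI g]]) blast+
  have hom: "circle_hom \<chi>" using \<chi>(1) by (simp add: circle_hom_def)
  then have cyclic: "p * \<chi> x \<in> \<int>" for x using \<chi>(2)[OF rangeI] by (rule circle_hom_times)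
  have "enat (1 + 2) \<le> X_G TYPE('a) (Suc 1)"
    by (rule X_G_ge_of_cyclic[where l = "(p - 2) div 2", OF inf hom g1 _ _ _ _ cyclic]) (use p in auto)
  then show "enat 3 \<le> X_G TYPE('a) 2" by (simp add: numeral_eq_Suc)
  have "enat (2 + 2) \<le> X_G TYPE('a) (Suc 2)"
    by (rule X_G_ge_of_cyclic[where l = 1, OF inf hom g1 _ _ _ _ cyclic]) (use p in auto)
  then show "enat 4 \<le> X_G TYPE('a) 3" by (simp add: numeral_eq_Suc)
qed

text \<open>Writing x as p y + t with t in a finite set gives n x = (n p) y + n t, so the factor p
  can be cancelled.\<close>

lemma finite_range_zmul_mult:
  assumes fo: "finite_over p (UNIV :: 'a::ab_group_add set)"
    and fin: "finite (range (zmul (int (n * p)) :: 'a \<Rightarrow> 'a))"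
  shows "finite (range (zmul (int n) :: 'a \<Rightarrow> 'a))"
proof -
  obtain T where T: "finite T" "\<And>x :: 'a. \<exists>y. \<exists>t\<in>T. x = zmul (int p) y + t"
    using fo unfolding finite_over_def by blast
  have "range (zmul (int n)) \<subseteq> (\<lambda>(x, t). x + zmul (int n) t) ` (range (zmul (int (n * p))) \<times> T)"
  proof safe
    fix x :: 'a
    obtain y t where "t \<in> T" "x = zmul (int p) y + t" using T(2) by blast
    then show "zmul (int n) x \<in> (\<lambda>(x, t). x + zmul (int n) t) ` (range (zmul (int (n * p))) \<times> T)"
      by (intro rev_image_eqI[of "(zmul (int (n * p)) y, t)"]) (auto simp: zmul_add_right zmul_zmul)
  qed
  then show ?thesis using fin T(1) by (meson finite_SigmaI finite_imageI finite_subset)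
qed

lemma X_G_lower_bounds:
  assumes inf: "infinite (UNIV :: 'a::ab_group_add set)"
  shows "enat 3 \<le> X_G TYPE('a) 2 \<and> enat 4 \<le> X_G TYPE('a) 3"
proof (rule ccontr)
  assume neg: "\<not> ?thesis"
  \<comment> \<open>All element orders are at most 7, and 420 is the least common multiple of 1 to
    7.\<close>
  have exponent: "zmul 420 g = 0" for g :: 'a
  proof -
    have "add_subgroup {k. zmul k g = 0}" by (simp add: add_subgroup_def zmul_diff_left)
    then obtain n where n: "n \<ge> 0" "zmul n g = 0" "\<And>k. zmul k g = 0 \<Longrightarrow> n dvd k"
      by (rule int_subgroup_generator) auto
    have "n \<noteq> 0"
    proof
      assume "n = 0"
      then have "int 8 dvd k" if "zmul k g = 0" for k using n(3)[OF that] by simp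
      with X_G_ge_of_large_order[OF inf, of 8 g] neg show False by auto
    qed
    moreover have "n < 8"
    proof (rule ccontr)
      assume "\<not> n < 8"
      with X_G_ge_of_large_order[OF inf, of "nat n" g] n neg show False by auto
    qed
    ultimately have "n \<in> {1, 2, 3, 4, 5, 6, 7}" using n(1) by auto
    then have "n dvd 420" by auto
    then obtain j where "420 = j * n" by (metis dvd_def mult.commute)
    then have "zmul 420 g = zmul j (zmul n g)" by (simp add: zmul_zmul)
    then show ?thesis using n(2) by simp
  qed
  \<comment> \<open>Every element is divisible by 5 and by 7, hence of the form 35 y, and 12 * 35 =
    420.\<close>
  have "zmul 12 g = 0" for g :: 'a
  proof -
    obtain x where x: "g = zmul (int 5) x" using X_G_ge_of_not_divisible[OF inf, of 5 g] neg by blast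
    obtain y where y: "x = zmul (int 7) y" using X_G_ge_of_not_divisible[OF inf, of 7 x] neg by blast
    have "zmul 12 g = zmul 420 y" by (simp add: x y zmul_zmul)
    with exponent show ?thesis by simp
  qed
  \<comment> \<open>The product is kept factored so that \<open>finite_range_zmul_mult\<close> can
    remove 3, then 2 twice, leaving the group itself finite.\<close>
  then have "zmul (int (1 * 2 * 2 * 3)) = (\<lambda>_. 0 :: 'a)" by auto
  then have "finite (range (zmul (int (1 * 2 * 2 * 3)) :: 'a \<Rightarrow> 'a))" by simp
  moreover have "finite_over 2 (UNIV :: 'a set)" "finite_over 3 (UNIV :: 'a set)"
    using X_G_ge_of_not_finite_over_2[OF inf] X_G_ge_of_not_finite_over_3[OF inf] neg by blast+
  ultimately have "finite (range (zmul (int 1) :: 'a \<Rightarrow> 'a))"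
    using finite_range_zmul_mult by blast
  with inf show False by simp
qed

theorem theorem1p6:
  assumes "infinite (UNIV :: 'a::ab_group_add set)"
  shows "(3 \<le> X_G TYPE('a) 2 \<and> X_G TYPE('a) 2 \<le> 5) \<and>
         (4 \<le> X_G TYPE('a) 3 \<and> X_G TYPE('a) 3 \<le> 17)"
proof -
  have "enat 4 \<le> 5" "enat 10 \<le> 17" by (simp_all add: numeral_eq_enat)
  then have "X_G TYPE('a) 2 \<le> 5" "X_G TYPE('a) 3 \<le> 17"
    using X_G_2_le[OF assms] X_G_3_le[OF assms] order_trans by blast+
  with X_G_lower_bounds[OF assms] show ?thesis by (simp add: numeral_eq_enat)
qed

end
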